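(* (i) Let $\mathcal{R}$ be a two-story region and let $t_0,t_1$ be tilings of $\mathcal{R}$ such that $t_1$ is obtained from $t_0$ by a single positive trit. Then $P_{t_1}(q)-P_{t_0}(q)=q^k(q-1)$ for some $k\in\mathbb{Z}$; consequently $P_{t_1}'(1)-P_{t_0}'(1)=1$. (ii) If $\mathcal{R}$ is a duplex region and $t_0,t_1$ are any two tilings of $\mathcal{R}$, then there is a finite sequence of flips and trits taking $t_0$ to $t_1$.
   Context: A basic cube is a closed unit cube $[x,x+1]\times[y,y+1]\times[z,z+1]$ with $(x,y,z)\in\mathbb{Z}^3$; it is white if $x+y+z$ is even and black if odd. A region is a finite union of basic cubes. A domino is the union of two basic cubes sharing a face; a tiling of a region is a covering of it by dominoes with pairwise disjoint interiors. A flip removes two dominoes of a tiling whose union is a $2\times2\times1$ box (in some orientation, integer vertices) and replaces them by the other pair of dominoes tiling that box. Trits: let $t$ be a tiling of a region $\mathcal{R}$ and $B=[l,l+2]\times[m,m+2]\times[n,n+2]$ with $l,m,n\in\mathbb{Z}$, and suppose exactly three dominoes of $t$ are contained in $B\cap\mathcal{R}$, no two of them parallel. They cover six of the eight unit cubes of $B$, and the two remaining cubes $h,h'$ are opposite corners of $B$. There is exactly one other way to cover these six cubes by three dominoes; replacing the three dominoes accordingly is a trit. For a set of three such dominoes, each domino consists of a cube $a$ sharing a face with $h$ and a cube $b$ sharing a face with $h'$; writing $c_X$ for the center of cube $X$, the number $\chi=\det(c_a-c_h,\,c_b-c_a,\,c_{h'}-c_b)\in\{\pm1\}$ does not depend on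 the domino chosen nor on the labelling of $h,h'$. The trit is positive if the three new dominoes have $\chi=+1$ (equivalently the three removed dominoes have $\chi=-1$), and negative otherwise. A planar region is a finite union of unit squares $[x,x+1]\times[y,y+1]\subset\mathbb{R}^2$, $x,y\in\mathbb{Z}$; such a square is black if $x+y$ is even and white if $x+y$ is odd; $c(Q)=\pm1$ accordingly ($+1$ for black). A duplex region is $\mathcal{D}\times[0,2]$ with $\mathcal{D}\subset\mathbb{R}^2$ a simply connected planar region with connected interior. A two-story region is a connected, simply connected region $\mathcal{R}\subset\mathbb{R}^2\times[0,2]$ whose two floors $\mathcal{R}\cap(\mathbb{R}^2\times[0,1])$ and $\mathcal{R}\cap(\mathbb{R}^2\times[1,2])$ are simply connected. The polynomial $P_t$: orient each domino of $t$ from the center of its white cube to the center of its black cube and project orthogonally onto $z=0$. Dominoes parallel to the $z$-axis project to single squares (jewels); others project to oriented unit segments between centers of adjacent squares. For a duplex region these segments form disjoint oriented closed curves. For a two-story region, let $\mathcal{D}'\times[0,2]$ be the smallest duplex region containing $\mathcal{R}$; a square of $\mathcal{D}'$ in only one floor is a source if the cube of $\mathcal{R}$ over it is black and a sink if it is white; fix ghost curves (curves from a source to a sink never touching the closure of a square $Q$ with $Q\times[0,2]\subseteq\mathcal{R}$) such that every source and every sink is an endpoint of exactly one ghost curve, and add them to the drawing to obtain closed oriented curves. For each jewel $j$ with center $p_j$, set $k_t(j)=\sum_\gamma\mathrm{wind}(\gamma,p_j)$ over all these closed curves, and $P_t(q)=\sum_j c(j)q^{k_t(j)}\in\mathbb{Z}[q,q^{-1}]$.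 *)

theory Defs
  imports
    "HOL-Complex_Analysis.Winding_Numbers"
    "HOL-Library.Poly_Mapping"
begin

section \<open>Cubiculated regions\<close>

text \<open>A basic cube is identified with its least corner, and a region with the finite set of its
  basic cubes; \<open>body\<close> is the subset of space which it stands for.\<close>

type_synonym cell = "int \<times> int \<times> int"

definition cube :: "cell \<Rightarrow> (real^3) set" where
  "cube = (\<lambda>(x, y, z). cbox (vector [of_int x, of_int y, of_int z])
                             (vector [of_int x + 1, of_int y + 1, of_int z + 1]))"

definition cube_center :: "cell \<Rightarrow> real^3" where
  "cube_center = (\<lambda>(x, y, z). vector [of_int x + 1/2, of_int y + 1/2, of_int z + 1/2])"

definition body :: "cell set \<Rightarrow> (real^3) set" where
  "body C = (\<Union>c\<in>C. cube c)"

definition white :: "cell \<Rightarrow> bool" where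
  "white = (\<lambda>(x, y, z). even (x + y + z))"

abbreviation black :: "cell \<Rightarrow> bool" where
  "black c \<equiv> \<not> white c"

definition share_face :: "cell \<Rightarrow> cell \<Rightarrow> bool" where
  "share_face = (\<lambda>(x, y, z) (x', y', z'). \<bar>x - x'\<bar> + \<bar>y - y'\<bar> + \<bar>z - z'\<bar> = 1)"

section \<open>Tilings, flips and trits\<close>

definition domino :: "cell set \<Rightarrow> bool" where
  "domino d \<longleftrightarrow> (\<exists>a b. share_face a b \<and> d = {a, b})"

definition tiling :: "cell set \<Rightarrow> cell set set \<Rightarrow> bool" where
  "tiling R t \<longleftrightarrow> (\<forall>d\<in>t. domino d) \<and> (\<Union>d\<in>t. body d) = body R \<and>
     pairwise (\<lambda>d e. interior (body d) \<inter> interior (body e) = {}) t"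

definition cell_box :: "cell \<Rightarrow> int \<times> int \<times> int \<Rightarrow> cell set" where
  "cell_box = (\<lambda>(l, m, n) (a, b, c). {l..<l+a} \<times> {m..<m+b} \<times> {n..<n+c})"

definition flip :: "cell set \<Rightarrow> cell set set \<Rightarrow> cell set set \<Rightarrow> bool" where
  "flip R t t' \<longleftrightarrow> tiling R t \<and>
     (\<exists>c s B p p'. s \<in> {(2, 2, 1), (2, 1, 2), (1, 2, 2)} \<and> B = cell_box c s \<and>
        p \<subseteq> t \<and> tiling B p \<and> tiling B p' \<and> p' \<noteq> p \<and> t' = (t - p) \<union> p')"

definition parallel :: "cell set \<Rightarrow> cell set \<Rightarrow> bool" where
  "parallel d e \<longleftrightarrow> (\<exists>a b v. d = {a, a + v} \<and> e = {b, b + v})"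

text \<open>The dominoes \<open>S\<close> of \<open>t\<close> inside the \<open>2 \<times> 2 \<times> 2\<close> box \<open>B\<close> are exchanged for \<open>S'\<close>.\<close>

definition trit_in ::
  "cell set \<Rightarrow> cell set \<Rightarrow> cell set set \<Rightarrow> cell set set \<Rightarrow> cell set set \<Rightarrow> cell set set \<Rightarrow> bool" where
  "trit_in R B S S' t t' \<longleftrightarrow> tiling R t \<and> (\<exists>c. B = cell_box c (2, 2, 2)) \<and>
     S = {d\<in>t. d \<subseteq> B \<inter> R} \<and> card S = 3 \<and> pairwise (\<lambda>d e. \<not> parallel d e) S \<and>
     tiling (\<Union>S) S' \<and> S' \<noteq> S \<and> t' = (t - S) \<union> S'"

definition trit :: "cell set \<Rightarrow> cell set set \<Rightarrow> cell set set \<Rightarrow> bool" where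
  "trit R t t' \<longleftrightarrow> (\<exists>B S S'. trit_in R B S S' t t')"

definition chi :: "cell \<Rightarrow> cell \<Rightarrow> cell \<Rightarrow> cell \<Rightarrow> real" where
  "chi h a b h' = det (vector [cube_center a - cube_center h, cube_center b - cube_center a,
                               cube_center h' - cube_center b] :: real^3^3)"

definition positive_trit :: "cell set \<Rightarrow> cell set set \<Rightarrow> cell set set \<Rightarrow> bool" where
  "positive_trit R t t' \<longleftrightarrow> (\<exists>B S S' h h'. trit_in R B S S' t t' \<and> B - \<Union>S = {h, h'} \<and>
     (\<forall>a b. {a, b} \<in> S' \<and> share_face a h \<and> share_face b h' \<longrightarrow> chi h a b h' = 1))"

section \<open>Duplex and two-story regions\<close>

text \<open>The plane is represented by the type of complex numbers, for which the library has
  winding numbers; planar squares are again given by their least corners.\<close>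

type_synonym square = "int \<times> int"

definition plane_square :: "square \<Rightarrow> complex set" where
  "plane_square = (\<lambda>(x, y). cbox (Complex (of_int x) (of_int y))
                                  (Complex (of_int x + 1) (of_int y + 1)))"

definition square_center :: "square \<Rightarrow> complex" where
  "square_center = (\<lambda>(x, y). Complex (of_int x + 1/2) (of_int y + 1/2))"

definition plane_body :: "square set \<Rightarrow> complex set" where
  "plane_body D = (\<Union>q\<in>D. plane_square q)"

definition square_sign :: "square \<Rightarrow> int" where
  "square_sign = (\<lambda>(x, y). if even (x + y) then 1 else - 1)"

definition duplex :: "cell set \<Rightarrow> bool" where
  "duplex R \<longleftrightarrow> (\<exists>D. finite D \<and> simply_connected (plane_body D) \<and>
     connected (interior (plane_body D)) \<and> R = {(x, y, z). (x, y) \<in> D \<and> z \<in> {0, 1}})"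

definition story :: "cell set \<Rightarrow> int \<Rightarrow> cell set" where
  "story R k = {(x, y, z) \<in> R. z = k}"

text \<open>The library's \<open>simply_connected\<close> includes path-connectedness. The floors of a two-story
  region are not assumed to be connected, so for them the condition is put on every component.\<close>

definition two_story :: "cell set \<Rightarrow> bool" where
  "two_story R \<longleftrightarrow> finite R \<and> (\<forall>(x, y, z)\<in>R. z \<in> {0, 1}) \<and>
     connected (body R) \<and> simply_connected (body R) \<and>
     (\<forall>k\<in>{0, 1}. \<forall>K\<in>components (body (story R k)). simply_connected K)"

section \<open>The polynomial of a tiling\<close>

definition proj :: "cell \<Rightarrow> square" where
  "proj = (\<lambda>(x, y, z). (x, y))"

definition full_squares :: "cell set \<Rightarrow> square set" where
  "full_squares R = {(x, y). (x, y, 0) \<in> R \<and> (x, y, 1) \<in> R}"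

definition sources :: "cell set \<Rightarrow> square set" where
  "sources R = {proj c | c. c \<in> R \<and> black c \<and> proj c \<notin> full_squares R}"

definition sinks :: "cell set \<Rightarrow> square set" where
  "sinks R = {proj c | c. c \<in> R \<and> white c \<and> proj c \<notin> full_squares R}"

definition ghost_curves :: "cell set \<Rightarrow> (real \<Rightarrow> complex) set \<Rightarrow> bool" where
  "ghost_curves R G \<longleftrightarrow>
     (\<forall>g\<in>G. path g \<and> pathstart g \<in> square_center ` sources R \<and>
        pathfinish g \<in> square_center ` sinks R \<and>
        path_image g \<inter> plane_body (full_squares R) = {}) \<and>
     (\<forall>q\<in>sources R. \<exists>!g. g \<in> G \<and> pathstart g = square_center q) \<and>
     (\<forall>q\<in>sinks R. \<exists>!g. g \<in> G \<and> pathfinish g = square_center q)"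

definition jewels :: "cell set set \<Rightarrow> square set" where
  "jewels t = {(x, y). {(x, y, 0), (x, y, 1)} \<in> t}"

definition segments :: "cell set set \<Rightarrow> (real \<Rightarrow> complex) set" where
  "segments t = {linepath (square_center (proj w)) (square_center (proj b)) | w b.
                   {w, b} \<in> t \<and> white w \<and> black b \<and> proj w \<noteq> proj b}"

definition closed_chain :: "(real \<Rightarrow> complex) list \<Rightarrow> bool" where
  "closed_chain gs \<longleftrightarrow> gs \<noteq> [] \<and>
     (\<forall>i<length gs. pathfinish (gs ! i) = pathstart (gs ! (Suc i mod length gs)))"

fun join_list :: "(real \<Rightarrow> complex) list \<Rightarrow> (real \<Rightarrow> complex)" where
  "join_list [] = (\<lambda>_. 0)"
| "join_list [g] = g"
| "join_list (g # h # gs) = g +++ join_list (h # gs)"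

text \<open>The closed curves formed by a set \<open>A\<close> of arcs. When every end of an arc of \<open>A\<close> is the start
  of exactly one arc of \<open>A\<close>, and conversely, as is the case for the drawing of a tiling, they are
  determined up to their order and the choice of their base points, neither of which affects the
  sum of the winding numbers.\<close>

definition closed_curves :: "(real \<Rightarrow> complex) set \<Rightarrow> (real \<Rightarrow> complex) list" where
  "closed_curves A = map join_list
     (SOME L. distinct (concat L) \<and> set (concat L) = A \<and> (\<forall>gs\<in>set L. closed_chain gs))"

definition wind :: "(real \<Rightarrow> complex) \<Rightarrow> complex \<Rightarrow> int" where
  "wind \<gamma> p = (THE n. winding_number \<gamma> p = of_int n)"

definition jewel_exponent :: "(real \<Rightarrow> complex) set \<Rightarrow> cell set set \<Rightarrow> square \<Rightarrow> int" where
  "jewel_exponent G t j = (\<Sum>\<gamma>\<leftarrow>closed_curves (segments t \<union> G). wind \<gamma> (square_center j))"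

text \<open>Laurent polynomials with integer coefficients form the monoid ring of the additive monoid
  of integers, with \<open>Poly_Mapping.single k a\<close> for the monomial of exponent \<open>k\<close> and coefficient
  \<open>a\<close>.\<close>

type_synonym laurent = "int \<Rightarrow>\<^sub>0 int"

abbreviation q_power :: "int \<Rightarrow> laurent" where
  "q_power k \<equiv> Poly_Mapping.single k 1"

definition tiling_poly :: "(real \<Rightarrow> complex) set \<Rightarrow> cell set set \<Rightarrow> laurent" where
  "tiling_poly G t = (\<Sum>j\<in>jewels t. Poly_Mapping.single (jewel_exponent G t j) (square_sign j))"

definition laurent_deriv :: "laurent \<Rightarrow> laurent" where
  "laurent_deriv p =
     (\<Sum>k\<in>Poly_Mapping.keys p. Poly_Mapping.single (k - 1) (k * Poly_Mapping.lookup p k))"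

definition laurent_eval :: "laurent \<Rightarrow> real \<Rightarrow> real" where
  "laurent_eval p x = (\<Sum>k\<in>Poly_Mapping.keys p. of_int (Poly_Mapping.lookup p k) * x powi k)"

end

theory Submission
  imports Defs "HOL-Combinatorics.Cycles"
begin

text \<open>Connectivity. Every tiling of a duplex region is joined to the one which consists of jewels only.
  The drawing of a tiling is a divergence-free flow on the square grid, so it has a height function
  on the grid vertices, which counts how often the curves wind around a vertex. Simple
  connectivity makes the height vanish on the boundary. At a suitable vertex of maximal positive
  height a flip, or a trit preceded by a flip, lowers the height by one: start at the leftmost
  maximum of the top row, and move one step to the right if the maxima form a pinched corner
  there. When the height is zero everywhere, the two floors agree and flips turn all
  dominoes into jewels.

  Polynomial. A trit moves a jewel between opposite squares of a \<open>2 \<times> 2\<close> block and moves the two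
  segments at one of these squares to the other one. The segment from either jewel
  to the centre of the block avoids the drawing which belongs to it, so both exponents
  can be read off at the centre, where they differ by the winding number of the boundary of the
  unit square. The other jewels are outside this unit square.\<close>

section \<open>Tilings as partitions\<close>

text \<open>The obstacle to connectivity is a maximum of the height where no flip is available: its
  left and upper neighbours are lower, the right and lower ones are not. Once a pinched corner is
  excluded, all four corners of the square to the lower right have the same height. No net flow
  crosses the sides of this square, and positivity of the height puts it inside the region. The
  horizontal dominoes over it then come as a pair stacked on the two floors; flipping the pair
  leaves the height alone and creates the jewel that the trit requires.

  The exponents use closed curves obtained by an arbitrary choice, so they are not compared curve by
  curve. Winding numbers of open arcs, though not integers, add up under joining. The sum over the
  curves is therefore a sum over the arcs, independent of the choice; in a difference only the arcs
  of the exchanged dominoes remain.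

  The change of the exponent in a positive trit equals the sign of the squares between which the
  jewel moves. This is why both colours lead to the same form of the difference.\<close>

lemma mem_cube:
  "w \<in> cube (x, y, z) \<longleftrightarrow> of_int x \<le> w $ 1 \<and> w $ 1 \<le> of_int x + 1 \<and>
     of_int y \<le> w $ 2 \<and> w $ 2 \<le> of_int y + 1 \<and> of_int z \<le> w $ 3 \<and> w $ 3 \<le> of_int z + 1"
  by (auto simp: cube_def mem_box_cart forall_3)

lemma cube_center_mem_interior_cube: "cube_center c \<in> interior (cube c)"
  by (cases c) (auto simp: cube_def cube_center_def interior_cbox mem_box_cart forall_3)

lemma cube_center_mem_cube_iff: "cube_center c \<in> cube c' \<longleftrightarrow> c = c'"
proof -
  obtain x y z where c: "c = (x, y, z)" by (cases c)
  obtain x' y' z' where c': "c' = (x', y', z')" by (cases c')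
  have *: "of_int a' \<le> (of_int a + 1/2 :: real) \<and> (of_int a + 1/2 :: real) \<le> of_int a' + 1 \<longleftrightarrow> a = a'"
    for a a' :: int by linarith
  show ?thesis
    using *[of x' x] *[of y' y] *[of z' z] by (auto simp: c c' mem_cube cube_center_def)
qed

lemma cube_center_mem_body_iff: "cube_center c \<in> body C \<longleftrightarrow> c \<in> C"
  by (auto simp: body_def cube_center_mem_cube_iff)

lemma body_eq_iff: "body C = body C' \<longleftrightarrow> C = C'"
  using cube_center_mem_body_iff by (metis subsetI subset_antisym)

lemma UN_body: "(\<Union>d\<in>t. body d) = body (\<Union>t)"
  by (auto simp: body_def)

lemma negligible_cube_Int_cube:
  assumes "c \<noteq> c'"
  shows "negligible (cube c \<inter> cube c')"
proof -
  obtain x y z where c: "c = (x, y, z)" by (cases c)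
  obtain x' y' z' where c': "c' = (x', y', z')" by (cases c')
  \<comment> \<open>Distinct integer unit intervals meet at most in the larger of their left ends,
    so distinct cubes meet inside a hyperplane.\<close>
  have *: "u = of_int (max a a')"
    if "a \<noteq> a'" "of_int a \<le> u" "u \<le> of_int a + 1" "of_int a' \<le> u" "u \<le> of_int a' + 1"
    for a a' :: int and u :: real
    using that by linarith
  have neg: "negligible {w :: real^3. w $ i = k}" for i k
    using negligible_standard_hyperplane[of "axis i 1 :: real^3" k]
    by (simp add: axis_in_Basis_iff cart_eq_inner_axis)
  consider "x \<noteq> x'" | "y \<noteq> y'" | "z \<noteq> z'"
    using assms c c' by auto
  then show ?thesis
  proof cases
    case 1
    then show ?thesis
      by (intro negligible_subset[OF neg[of 1 "of_int (max x x')"]]) (auto simp: c c' mem_cube intro: *)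
  next
    case 2
    then show ?thesis
      by (intro negligible_subset[OF neg[of 2 "of_int (max y y')"]]) (auto simp: c c' mem_cube intro: *)
  next
    case 3
    then show ?thesis
      by (intro negligible_subset[OF neg[of 3 "of_int (max z z')"]]) (auto simp: c c' mem_cube intro: *)
  qed
qed

text \<open>Distinct cubes overlap in a null set, and a nonempty open set is not null. Conversely,
  the centre of a common cube lies in both interiors.\<close>

lemma disjoint_interior_body_iff:
  assumes "finite d" "finite e"
  shows "interior (body d) \<inter> interior (body e) = {} \<longleftrightarrow> d \<inter> e = {}"
proof
  assume disj: "d \<inter> e = {}"
  have "body d \<inter> body e = (\<Union>(c, c')\<in>d \<times> e. cube c \<inter> cube c')"
    by (auto simp: body_def)
  moreover have "negligible (\<Union>(c, c')\<in>d \<times> e. cube c \<inter> cube c')"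
    using disj assms by (intro negligible_Union) (auto intro!: negligible_cube_Int_cube)
  ultimately have "negligible (body d \<inter> body e)"
    by (simp only:)
  then have "negligible (interior (body d) \<inter> interior (body e))"
    by (rule negligible_subset) (intro Int_mono interior_subset)
  then show "interior (body d) \<inter> interior (body e) = {}"
    using open_not_negligible[of "interior (body d) \<inter> interior (body e)"] by (meson open_Int open_interior)
next
  assume "interior (body d) \<inter> interior (body e) = {}"
  moreover have "cube_center c \<in> interior (body C)" if "c \<in> C" for c C
    using cube_center_mem_interior_cube[of c] interior_mono[of "cube c" "body C"] that
    by (auto simp: body_def)
  ultimately show "d \<inter> e = {}"
    by blast
qed

section \<open>Dominoes and tilings as set partitions\<close>

lemma share_face_irrefl: "\<not> share_face c c"
  by (auto simp: share_face_def)

lemma finite_domino: "domino d \<Longrightarrow> finite d"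
  by (auto simp: domino_def)

lemma domino_nonempty: "domino d \<Longrightarrow> d \<noteq> {}"
  by (auto simp: domino_def)

text \<open>Removes the geometry: afterwards a tiling is a partition of the cells into
  dominoes.\<close>

lemma tiling_iff: "tiling R t \<longleftrightarrow> (\<forall>d\<in>t. domino d) \<and> \<Union>t = R \<and> pairwise disjnt t"
proof -
  have "pairwise (\<lambda>d e. interior (body d) \<inter> interior (body e) = {}) t \<longleftrightarrow> pairwise disjnt t"
    if "\<forall>d\<in>t. domino d"
    using that by (simp add: pairwise_def disjnt_def disjoint_interior_body_iff finite_domino)
  then show ?thesis
    by (auto simp: tiling_def UN_body body_eq_iff)
qed

lemma tiling_domino: "tiling R t \<Longrightarrow> d \<in> t \<Longrightarrow> domino d"
  by (simp add: tiling_iff)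

lemma tiling_subset: "tiling R t \<Longrightarrow> d \<in> t \<Longrightarrow> d \<subseteq> R"
  by (auto simp: tiling_iff)

lemma tiling_cover: "tiling R t \<Longrightarrow> c \<in> R \<Longrightarrow> \<exists>d\<in>t. c \<in> d"
  by (auto simp: tiling_iff)

lemma tiling_disjnt: "tiling R t \<Longrightarrow> d \<in> t \<Longrightarrow> e \<in> t \<Longrightarrow> d \<noteq> e \<Longrightarrow> disjnt d e"
  by (simp add: tiling_iff pairwise_def)

lemma tiling_unique: "tiling R t \<Longrightarrow> d \<in> t \<Longrightarrow> e \<in> t \<Longrightarrow> c \<in> d \<Longrightarrow> c \<in> e \<Longrightarrow> d = e"
  using tiling_disjnt[of R t d e] by (auto simp: disjnt_def)

lemma tiling_partner_unique: "tiling R t \<Longrightarrow> {a, b} \<in> t \<Longrightarrow> {a, c} \<in> t \<Longrightarrow> b = c"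
  using tiling_unique[of R t "{a, b}" "{a, c}" a] by (auto simp: doubleton_eq_iff)

section \<open>Exchanging dominoes inside a tiling\<close>

lemma tiling_exchange:
  assumes t: "tiling R t" and p: "p \<subseteq> t" and p': "tiling (\<Union>p) p'"
  shows "tiling R ((t - p) \<union> p')" and "((t - p) \<union> p') - p' = t - p"
    and "(((t - p) \<union> p') - p') \<union> p = t"
proof -
  have disj: "disjnt d e" if "d \<in> t - p" "e \<in> p'" for d e
  proof -
    have "e \<subseteq> \<Union>p"
      using tiling_subset[OF p'] that by blast
    moreover have "disjnt d f" if "f \<in> p" for f
      using tiling_disjnt[OF t, of d f] p that \<open>d \<in> t - p\<close> by (metis Diff_iff subsetD)
    ultimately show ?thesis
      unfolding disjnt_def by blast
  qed
  show 1: "((t - p) \<union> p') - p' = t - p"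
  proof -
    have "e \<notin> t - p" if "e \<in> p'" for e
      using disj[of e e] domino_nonempty[OF tiling_domino[OF p' that]] that by (auto simp: disjnt_def)
    then show ?thesis by blast
  qed
  show "(((t - p) \<union> p') - p') \<union> p = t"
    unfolding 1 using p by blast
  show "tiling R ((t - p) \<union> p')"
    unfolding tiling_iff
  proof (intro conjI)
    show "\<forall>d\<in>(t - p) \<union> p'. domino d"
      using t p' by (auto simp: tiling_iff)
    have "\<Union>p' = \<Union>p"
      using p' by (simp add: tiling_iff)
    then show "\<Union>((t - p) \<union> p') = R"
      using t p by (auto simp: tiling_iff)
    show "pairwise disjnt ((t - p) \<union> p')"
      using t p' disj by (auto simp: tiling_iff pairwise_def disjnt_sym)
  qed
qed

text \<open>The flip is undone by the opposite one because removing the new pair leaves exactly the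
  untouched rest of the old tiling.\<close>

lemma flip_exchange:
  assumes t: "tiling R t" and p: "p \<subseteq> t" "tiling (cell_box c s) p" "tiling (cell_box c s) p'" "p' \<noteq> p"
    and s: "s \<in> {(2, 2, 1), (2, 1, 2), (1, 2, 2)}"
  defines "t' \<equiv> (t - p) \<union> p'"
  shows "tiling R t'" "flip R t t'" "flip R t' t"
proof -
  have U: "\<Union>p = cell_box c s" "\<Union>p' = cell_box c s"
    using p by (auto simp: tiling_iff)
  note ex = tiling_exchange[OF t p(1), of p', unfolded U, OF p(3), folded t'_def]
  show "tiling R t'" by (rule ex)
  show "flip R t t'"
    unfolding flip_def t'_def using assms by blast
  have "p' \<subseteq> t'" by (auto simp: t'_def)
  then show "flip R t' t"
    unfolding flip_def using ex p s by metis
qed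

text \<open>A trit has to take all dominoes of the tiling inside the box. At most \<open>h\<close>
  and \<open>h'\<close> are left over, and they share no face, so no further domino fits into the
  box.\<close>

lemma trit_exchange:
  assumes t: "tiling R t" and S: "S \<subseteq> t" "\<Union>S \<subseteq> cell_box c (2, 2, 2)" "card S = 3"
      "pairwise (\<lambda>d e. \<not> parallel d e) S"
    and S': "tiling (\<Union>S) S'" "S' \<noteq> S"
    and h: "cell_box c (2, 2, 2) - \<Union>S \<subseteq> {h, h'}" "\<not> share_face h h'"
  defines "t' \<equiv> (t - S) \<union> S'"
  shows "tiling R t'" "trit R t t'"
proof -
  show "tiling R t'"
    unfolding t'_def using tiling_exchange[OF t S(1) S'(1)] by blast
  have "S = {d\<in>t. d \<subseteq> cell_box c (2, 2, 2) \<inter> R}"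
  proof (intro equalityI subsetI)
    fix d assume "d \<in> S"
    then show "d \<in> {d\<in>t. d \<subseteq> cell_box c (2, 2, 2) \<inter> R}"
      using S tiling_subset[OF t] by blast
  next
    fix d assume d: "d \<in> {d\<in>t. d \<subseteq> cell_box c (2, 2, 2) \<inter> R}"
    show "d \<in> S"
    proof (rule ccontr)
      assume "d \<notin> S"
      then have "d \<inter> \<Union>S = {}"
        using d S(1) tiling_disjnt[OF t, of d] by (fastforce simp: disjnt_def)
      then have "d \<subseteq> {h, h'}" using d h by blast
      moreover have "domino d" using d tiling_domino[OF t] by blast
      ultimately have "share_face h h' \<or> share_face h' h"
        using share_face_irrefl by (auto simp: domino_def)
      then show False using h(2) by (auto simp: share_face_def split: prod.splits)
    qed
  qed
  then show "trit R t t'"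
    unfolding trit_def trit_in_def t'_def using t S S' by blast
qed

lemma cell_box_cells:
  "cell_box (x, y, z) (2, 2, 1) = {(x, y, z), (x + 1, y, z), (x, y + 1, z), (x + 1, y + 1, z)}"
  "cell_box (x, y, z) (2, 1, 2) = {(x, y, z), (x + 1, y, z), (x, y, z + 1), (x + 1, y, z + 1)}"
  "cell_box (x, y, z) (1, 2, 2) = {(x, y, z), (x, y + 1, z), (x, y, z + 1), (x, y + 1, z + 1)}"
  "cell_box (x, y, z) (2, 2, 2) = {x, x + 1} \<times> {y, y + 1} \<times> {z, z + 1}"
proof -
  have "{a..<a + 2} = {a, a + 1}" "{a..<a + 1} = {a}" for a :: int
    by auto
  then show "cell_box (x, y, z) (2, 2, 1) = {(x, y, z), (x + 1, y, z), (x, y + 1, z), (x + 1, y + 1, z)}"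
    "cell_box (x, y, z) (2, 1, 2) = {(x, y, z), (x + 1, y, z), (x, y, z + 1), (x + 1, y, z + 1)}"
    "cell_box (x, y, z) (1, 2, 2) = {(x, y, z), (x, y + 1, z), (x, y, z + 1), (x, y + 1, z + 1)}"
    "cell_box (x, y, z) (2, 2, 2) = {x, x + 1} \<times> {y, y + 1} \<times> {z, z + 1}"
    by (auto simp: cell_box_def)
qed

section \<open>Duplex regions: the height function\<close>

definition prism :: "square set \<Rightarrow> cell set" where
  "prism D = {(x, y, z). (x, y) \<in> D \<and> z \<in> {0, 1}}"

definition xdom :: "int \<Rightarrow> int \<Rightarrow> int \<Rightarrow> cell set" where
  "xdom x y z = {(x, y, z), (x + 1, y, z)}"

definition ydom :: "int \<Rightarrow> int \<Rightarrow> int \<Rightarrow> cell set" where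
  "ydom x y z = {(x, y, z), (x, y + 1, z)}"

definition zdom :: "int \<Rightarrow> int \<Rightarrow> cell set" where
  "zdom x y = {(x, y, 0), (x, y, 1)}"

lemma mem_xdom: "c \<in> xdom x y z \<longleftrightarrow> c = (x, y, z) \<or> c = (x + 1, y, z)"
  and mem_ydom: "c \<in> ydom x y z \<longleftrightarrow> c = (x, y, z) \<or> c = (x, y + 1, z)"
  and mem_zdom: "c \<in> zdom x y \<longleftrightarrow> c = (x, y, 0) \<or> c = (x, y, 1)"
  by (auto simp: xdom_def ydom_def zdom_def)

lemmas mem_dom = mem_xdom mem_ydom mem_zdom

lemma dom_eq_iff [simp]:
  "xdom x y z = xdom x' y' z' \<longleftrightarrow> x = x' \<and> y = y' \<and> z = z'"
  "ydom x y z = ydom x' y' z' \<longleftrightarrow> x = x' \<and> y = y' \<and> z = z'"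
  "zdom x y = zdom x' y' \<longleftrightarrow> x = x' \<and> y = y'"
  "xdom x y z \<noteq> ydom x' y' z'" "ydom x y z \<noteq> xdom x' y' z'" "xdom x y z \<noteq> zdom x' y'"
  "zdom x y \<noteq> xdom x' y' z'" "ydom x y z \<noteq> zdom x' y'" "zdom x y \<noteq> ydom x' y' z'"
  by (auto simp: xdom_def ydom_def zdom_def doubleton_eq_iff)

lemma domino_dom [simp]: "domino (xdom x y z)" "domino (ydom x y z)" "domino (zdom x y)"
proof -
  have "share_face (x, y, z) (x + 1, y, z)" "share_face (x, y, z) (x, y + 1, z)"
      "share_face (x, y, 0) (x, y, 1)"
    by (auto simp: share_face_def)
  then show "domino (xdom x y z)" "domino (ydom x y z)" "domino (zdom x y)"
    unfolding domino_def xdom_def ydom_def zdom_def by blast+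
qed

lemma domino_cases:
  assumes "domino d" "\<forall>(x, y, z)\<in>d. z \<in> {0, 1}"
  obtains x y z where "d = xdom x y z" "z \<in> {0, 1}" | x y z where "d = ydom x y z" "z \<in> {0, 1}"
    | x y where "d = zdom x y"
proof -
  obtain x y z x' y' z' where d: "d = {(x, y, z), (x', y', z')}"
      and s: "\<bar>x - x'\<bar> + \<bar>y - y'\<bar> + \<bar>z - z'\<bar> = 1"
    using assms by (auto simp: domino_def share_face_def)
  have z: "z \<in> {0, 1}" "z' \<in> {0, 1}"
    using assms(2) by (auto simp: d)
  from s consider "x' = x + 1 \<and> y' = y \<and> z' = z" | "x = x' + 1 \<and> y' = y \<and> z' = z"
    | "x' = x \<and> y' = y + 1 \<and> z' = z" | "x' = x \<and> y = y' + 1 \<and> z' = z"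
    | "x' = x \<and> y' = y \<and> z' \<noteq> z"
    by (cases "x = x'"; cases "y = y'"; cases "z = z'") (auto simp: abs_if split: if_splits)
  then show thesis
  proof cases
    case 1 then show ?thesis using that(1)[of x y z] z d by (auto simp: xdom_def)
  next
    case 2 then show ?thesis using that(1)[of x' y z] z d by (auto simp: xdom_def insert_commute)
  next
    case 3 then show ?thesis using that(2)[of x y z] z d by (auto simp: ydom_def)
  next
    case 4 then show ?thesis using that(2)[of x y' z] z d by (auto simp: ydom_def insert_commute)
  next
    case 5 then show ?thesis using that(3)[of x y] z d by (auto simp: zdom_def insert_commute)
  qed
qed

section \<open>The flow of a duplex tiling and its stream function\<close>

definition weight :: "int \<Rightarrow> cell \<Rightarrow> int" where
  "weight \<sigma> c = (if white c then \<sigma> else - \<sigma>)"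

text \<open>The signed number of dominoes of \<open>t\<close> which project to an edge of the square grid, each
  oriented from its white to its black cube and counted positively if that is the orientation of
  the axis. The sign \<open>\<sigma>\<close> lets maxima and minima of the heights be treated alike.\<close>

definition xflow :: "int \<Rightarrow> cell set set \<Rightarrow> int \<Rightarrow> int \<Rightarrow> int" where
  "xflow \<sigma> t x y = (\<Sum>z\<in>{0, 1}. weight \<sigma> (x, y, z) * of_bool (xdom x y z \<in> t))"

definition yflow :: "int \<Rightarrow> cell set set \<Rightarrow> int \<Rightarrow> int \<Rightarrow> int" where
  "yflow \<sigma> t x y = (\<Sum>z\<in>{0, 1}. weight \<sigma> (x, y, z) * of_bool (ydom x y z \<in> t))"

lemma weight_neighbour:
  "weight \<sigma> (x + 1, y, z) = - weight \<sigma> (x, y, z)" "weight \<sigma> (x, y + 1, z) = - weight \<sigma> (x, y, z)"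
  "weight \<sigma> (x - 1, y, z) = - weight \<sigma> (x, y, z)" "weight \<sigma> (x, y - 1, z) = - weight \<sigma> (x, y, z)"
  "weight \<sigma> (x, y, 1) = - weight \<sigma> (x, y, 0)"
  by (auto simp: weight_def white_def)

lemma xflow_eq: "xflow \<sigma> t x y =
    weight \<sigma> (x, y, 0) * (of_bool (xdom x y 0 \<in> t) - of_bool (xdom x y 1 \<in> t))"
  and yflow_eq: "yflow \<sigma> t x y =
    weight \<sigma> (x, y, 0) * (of_bool (ydom x y 0 \<in> t) - of_bool (ydom x y 1 \<in> t))"
  by (simp_all add: xflow_def yflow_def weight_neighbour(5) algebra_simps)

text \<open>The argument \<open>(x, y)\<close> of a height function is the least corner of the square \<open>(x, y)\<close>, so the
  edge of the grid from the vertex \<open>(x, y)\<close> to \<open>(x + 1, y)\<close> separates the squares \<open>(x, y - 1)\<close> and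
  \<open>(x, y)\<close>.\<close>

definition is_height :: "int \<Rightarrow> cell set set \<Rightarrow> (int \<times> int \<Rightarrow> int) \<Rightarrow> bool" where
  "is_height \<sigma> t h \<longleftrightarrow> finite {v. h v \<noteq> 0} \<and>
     (\<forall>x y. h (x + 1, y) = h (x, y) - yflow \<sigma> t x (y - 1)) \<and>
     (\<forall>x y. h (x, y + 1) = h (x, y) + xflow \<sigma> t (x - 1) y)"

lemma is_height_uminus: "is_height \<sigma> t h \<Longrightarrow> is_height (- \<sigma>) t (\<lambda>v. - h v)"
  by (simp add: is_height_def xflow_eq yflow_eq weight_def)

text \<open>Each cell lies in exactly one domino. The right-hand side is independent of
  \<open>z\<close>, and this is the point: both floors have equally many horizontal dominoes over a
  square.\<close>

lemma horizontal_count: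
  assumes t: "tiling (prism D) t" and z: "z \<in> {0, 1}"
  shows "of_bool (xdom x y z \<in> t) + of_bool (xdom (x - 1) y z \<in> t) + of_bool (ydom x y z \<in> t) +
     of_bool (ydom x (y - 1) z \<in> t) = (of_bool ((x, y) \<in> D \<and> zdom x y \<notin> t) :: int)"
proof -
  let ?c = "(x, y, z)"
  let ?N = "{xdom x y z, xdom (x - 1) y z, ydom x y z, ydom x (y - 1) z, zdom x y}"
  have inN: "d \<in> ?N \<Longrightarrow> ?c \<in> d" for d
    using z by (auto simp: mem_dom)
  have uniq: "d \<in> ?N \<Longrightarrow> e \<in> ?N \<Longrightarrow> d \<in> t \<Longrightarrow> e \<in> t \<Longrightarrow> d = e" for d e
    using tiling_unique[OF t _ _ inN inN] by blast
  show ?thesis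
  proof (cases "(x, y) \<in> D")
    case True
    then obtain d where d: "d \<in> t" "?c \<in> d"
      using tiling_cover[OF t, of ?c] z by (auto simp: prism_def)
    have "\<forall>(x, y, z)\<in>d. z \<in> {0, 1}"
      using tiling_subset[OF t d(1)] by (auto simp: prism_def)
    then have "d \<in> ?N"
      using d(2) by (cases rule: domino_cases[OF tiling_domino[OF t d(1)]]) (auto simp: mem_dom)
    moreover have "e \<in> t \<longleftrightarrow> e = d" if "e \<in> ?N" for e
      using uniq[OF \<open>d \<in> ?N\<close> that d(1)] d(1) by blast
    ultimately show ?thesis
      using True by (elim insertE emptyE) simp_all
  next
    case False
    then have "d \<notin> t" if "d \<in> ?N" for d
      using tiling_subset[OF t, of d] inN[OF that] by (auto simp: prism_def)
    then show ?thesis using False by simp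
  qed
qed

text \<open>The two cubes over a square have opposite colours, so the equal counts on the two floors
  enter with opposite signs.\<close>

lemma flow_divergence:
  assumes t: "tiling (prism D) t"
  shows "xflow \<sigma> t x y - xflow \<sigma> t (x - 1) y + yflow \<sigma> t x y - yflow \<sigma> t x (y - 1) = 0"
proof -
  have "xflow \<sigma> t x y - xflow \<sigma> t (x - 1) y + yflow \<sigma> t x y - yflow \<sigma> t x (y - 1) = weight \<sigma> (x, y, 0) *
    ((of_bool (xdom x y 0 \<in> t) + of_bool (xdom (x - 1) y 0 \<in> t) + of_bool (ydom x y 0 \<in> t) +
        of_bool (ydom x (y - 1) 0 \<in> t)) -
     (of_bool (xdom x y 1 \<in> t) + of_bool (xdom (x - 1) y 1 \<in> t) + of_bool (ydom x y 1 \<in> t) +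
        of_bool (ydom x (y - 1) 1 \<in> t)))"
    unfolding xflow_eq yflow_eq weight_neighbour(3,4) by (simp only: algebra_simps mult_minus_left)
  also have "\<dots> = 0"
    using horizontal_count[OF t, of 0 x y] horizontal_count[OF t, of 1 x y] by (simp only: insertI1 insertI2) simp
  finally show ?thesis .
qed

lemma flow_outside:
  assumes t: "tiling (prism D) t"
  shows "(x, y) \<notin> D \<or> (x + 1, y) \<notin> D \<Longrightarrow> xflow \<sigma> t x y = 0"
    and "(x, y) \<notin> D \<or> (x, y + 1) \<notin> D \<Longrightarrow> yflow \<sigma> t x y = 0"
  using tiling_subset[OF t, of "xdom x y _"] tiling_subset[OF t, of "ydom x y _"]
  by (auto simp: xflow_eq yflow_eq xdom_def ydom_def prism_def)

text \<open>The height is a discrete stream function: it sums the vertical flow along a row,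
  starting to the left of the region. Zero divergence turns its vertical increments into the
  horizontal flow.\<close>

lemma height_exists:
  assumes t: "tiling (prism D) t" and D: "finite D"
  shows "\<exists>h. is_height \<sigma> t h"
proof -
  obtain N where N: "\<And>x y. (x, y) \<in> D \<Longrightarrow> \<bar>x\<bar> < N \<and> \<bar>y\<bar> < N"
  proof -
    let ?N = "Max (insert 0 ((\<lambda>(x, y). max \<bar>x\<bar> \<bar>y\<bar>) ` D)) + 1"
    have "max \<bar>x\<bar> \<bar>y\<bar> < ?N" if "(x, y) \<in> D" for x y
    proof -
      have "max \<bar>x\<bar> \<bar>y\<bar> \<le> Max (insert 0 ((\<lambda>(x, y). max \<bar>x\<bar> \<bar>y\<bar>) ` D))"
        using D that by (intro Max_ge) (auto intro!: rev_image_eqI)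
      then show ?thesis by linarith
    qed
    then show thesis by (intro that[of ?N]) auto
  qed
  have xz: "xflow \<sigma> t x y = 0" "yflow \<sigma> t x y = 0" if "\<bar>x\<bar> \<ge> N \<or> \<bar>y\<bar> \<ge> N" for x y
    using flow_outside[OF t] N[of x y] that by fastforce+
  define h where "h = (\<lambda>(x, y). - (\<Sum>i\<in>{-N..<x}. yflow \<sigma> t i (y - 1)))"
  have hx: "h (x + 1, y) = h (x, y) - yflow \<sigma> t x (y - 1)" for x y
  proof (cases "x \<ge> - N")
    case True
    then have "{-N..<x + 1} = insert x {-N..<x}" by auto
    then show ?thesis by (simp add: h_def)
  next
    case False
    then have "yflow \<sigma> t x (y - 1) = 0" by (intro xz) linarith
    then show ?thesis using False by (simp add: h_def)
  qed
  have hy: "h (x, y + 1) = h (x, y) + xflow \<sigma> t (x - 1) y" for x y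
  proof (cases "x \<ge> - N")
    case True
    have "(\<Sum>i\<in>{-N..<x}. yflow \<sigma> t i y - yflow \<sigma> t i (y - 1)) = - xflow \<sigma> t (x - 1) y"
      using True
    proof (induction x rule: int_ge_induct)
      case base
      have "xflow \<sigma> t (- N - 1) y = 0" by (intro xz) linarith
      then show ?case by simp
    next
      case (step x)
      then have "{-N..<x + 1} = insert x {-N..<x}" by auto
      then show ?case using step flow_divergence[OF t, of \<sigma> x y] by simp
    qed
    then show ?thesis by (simp add: h_def sum_subtractf)
  next
    case False
    then have "xflow \<sigma> t (x - 1) y = 0" by (intro xz) linarith
    then show ?thesis using False by (simp add: h_def)
  qed
  \<comment> \<open>Beside the region there is no horizontal flow, so the height is constant along
    these columns and can be read off in a row above the region.\<close>
  have up: "h (x, y + int n) = h (x, y)" if "\<bar>x - 1\<bar> \<ge> N" for x y n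
  proof (induction n)
    case (Suc n)
    show ?case using hy[of x "y + int n"] Suc xz[of "x - 1" "y + int n"] that by (simp add: algebra_simps)
  qed simp
  have "h (x, y) = 0" if "\<bar>x\<bar> > N + 1 \<or> \<bar>y\<bar> > N + 1" for x y
  proof (cases "\<bar>y\<bar> > N + 1")
    case True
    then have "\<bar>y - 1\<bar> \<ge> N" by linarith
    then show ?thesis by (simp add: h_def xz)
  next
    case False
    then have x: "\<bar>x - 1\<bar> \<ge> N" using that by linarith
    \<comment> \<open>From any row with \<open>\<bar>y\<bar> \<le> N + 1\<close> this shift leads
      above the region; the absolute value is there because the sign of \<open>N\<close> has not
      been recorded.\<close>
    have "h (x, y) = h (x, y + int (nat (2 * \<bar>N\<bar> + 3)))"
      by (rule up[OF x, symmetric])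
    also have "yflow \<sigma> t i (y + int (nat (2 * \<bar>N\<bar> + 3)) - 1) = 0" for i
      using False by (intro xz) linarith
    then have "h (x, y + int (nat (2 * \<bar>N\<bar> + 3))) = 0"
      by (simp only: h_def prod.case sum.neutral_const minus_zero)
    finally show ?thesis .
  qed
  then have "\<bar>x\<bar> \<le> N + 1 \<and> \<bar>y\<bar> \<le> N + 1" if "h (x, y) \<noteq> 0" for x y
    using that by (meson not_le)
  then have "{v. h v \<noteq> 0} \<subseteq> {-N-1..N+1} \<times> {-N-1..N+1}"
    by (force simp: abs_le_iff)
  then have "finite {v. h v \<noteq> 0}"
    by (rule finite_subset) simp
  then show ?thesis using hx hy by (auto simp: is_height_def)
qed

section \<open>Heights vanish at the boundary\<close>

lemma mem_plane_square: "w \<in> plane_square (x, y) \<longleftrightarrow>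
    of_int x \<le> Re w \<and> Re w \<le> of_int x + 1 \<and> of_int y \<le> Im w \<and> Im w \<le> of_int y + 1"
  by (auto simp: plane_square_def in_cbox_complex_iff)

text \<open>Borsuk's criterion: a compact planar set does not separate the plane if all its maps to
  the punctured plane are inessential. Simple connectivity gives this for locally path-connected
  sets, such as finite unions of closed convex sets.\<close>

lemma connected_complement_plane_body:
  assumes D: "finite D" and sc: "simply_connected (plane_body D)"
  shows "connected (- plane_body D)"
proof -
  have "ANR (\<Union>(plane_square ` D))"
    using D by (intro ANR_finite_Union_convex_closed) (auto simp: plane_square_def)
  then have "locally path_connected (plane_body D)"
    by (simp add: plane_body_def ANR_imp_locally_path_connected)
  then have "Borsukian (plane_body D)"
    using sc by (simp add: simply_connected_imp_Borsukian)
  moreover have "compact (plane_body D)"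
    using D by (auto simp: plane_body_def plane_square_def intro!: compact_UN)
  ultimately show ?thesis
    by (simp add: Borsukian_separation_compact)
qed

text \<open>No domino projects to a pair containing a square outside the region, so no flow
  separates the corners of that square.\<close>

lemma height_corners_outside:
  assumes t: "tiling (prism D) t" and h: "is_height \<sigma> t h" and q: "(x, y) \<notin> D"
    and i: "i \<in> {x, x + 1}" and j: "j \<in> {y, y + 1}"
  shows "h (i, j) = h (x, y)"
proof -
  have "yflow \<sigma> t x (y - 1) = 0" "yflow \<sigma> t x y = 0" "xflow \<sigma> t (x - 1) y = 0" "xflow \<sigma> t x y = 0"
    using flow_outside[OF t] q by simp_all
  moreover have "h (x + 1, y) = h (x, y) - yflow \<sigma> t x (y - 1)"
      "h (x, y + 1) = h (x, y) + xflow \<sigma> t (x - 1) y"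
      "h (x + 1, y + 1) = h (x + 1, y) + xflow \<sigma> t x y"
    using h by (simp_all add: is_height_def)
  ultimately show ?thesis using i j by auto
qed

text \<open>The height is constant off the region since the complement is connected, and finite
  support makes the constant zero. This is where simple connectivity enters.\<close>

lemma height_zero_outside:
  assumes t: "tiling (prism D) t" and h: "is_height \<sigma> t h" and q: "(x, y) \<notin> D"
    and D: "finite D" and sc: "simply_connected (plane_body D)"
    and i: "i \<in> {x, x + 1}" and j: "j \<in> {y, y + 1}"
  shows "h (i, j) = 0"
proof -
  \<comment> \<open>the height, extended to the complement of the region, is locally constant there\<close>
  define H where "H = (\<lambda>w. h (\<lfloor>Re w\<rfloor>, \<lfloor>Im w\<rfloor>))"
  have centre_out: "square_center q \<in> - plane_body D" if "q \<notin> D" for q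
  proof -
    have "q = q'" if "square_center q \<in> plane_square q'" for q'
      using that by (cases q; cases q') (auto simp: square_center_def mem_plane_square; linarith)
    then show ?thesis using that by (auto simp: plane_body_def)
  qed
  have H_centre: "H (square_center q) = h q" for q
  proof (cases q)
    case (Pair a b)
    have "\<lfloor>of_int a + 1/2 :: real\<rfloor> = a" for a :: int by linarith
    then show ?thesis by (simp add: Pair H_def square_center_def)
  qed
  have "eventually (\<lambda>w'. H w = H w') (at w within - plane_body D)" if w: "w \<in> - plane_body D" for w
  proof -
    have near: "eventually (\<lambda>w'. f w' < of_int \<lfloor>f w\<rfloor> + 1 \<and> of_int \<lceil>f w\<rceil> - 1 < f w') (at w within - plane_body D)"
      if "(f \<longlongrightarrow> f w) (at w within - plane_body D)" for f :: "complex \<Rightarrow> real"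
      by (intro eventually_conj order_tendstoD[OF that]) linarith+
    have "eventually (\<lambda>w'. (Re w' < of_int \<lfloor>Re w\<rfloor> + 1 \<and> of_int \<lceil>Re w\<rceil> - 1 < Re w') \<and>
        (Im w' < of_int \<lfloor>Im w\<rfloor> + 1 \<and> of_int \<lceil>Im w\<rceil> - 1 < Im w')) (at w within - plane_body D)"
      by (intro eventually_conj[OF near near] tendsto_intros)
    then show ?thesis
    proof (rule eventually_mono)
      fix w' assume a: "(Re w' < of_int \<lfloor>Re w\<rfloor> + 1 \<and> of_int \<lceil>Re w\<rceil> - 1 < Re w') \<and>
        (Im w' < of_int \<lfloor>Im w\<rfloor> + 1 \<and> of_int \<lceil>Im w\<rceil> - 1 < Im w')"
      let ?x = "\<lfloor>Re w'\<rfloor>" and ?y = "\<lfloor>Im w'\<rfloor>"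
      \<comment> \<open>Near an integer coordinate of \<open>w\<close> the floor may drop by one. In
        either case \<open>w\<close> lies in the closed square whose least corner is the floor of
        \<open>w'\<close>, and the floor of \<open>w\<close> is a corner of that square. As
        \<open>w\<close> is off the region, so is the square.\<close>
      have *: "of_int \<lfloor>v\<rfloor> \<le> u \<and> u \<le> of_int \<lfloor>v\<rfloor> + 1 \<and> (\<lfloor>u\<rfloor> = \<lfloor>v\<rfloor> \<or> \<lfloor>u\<rfloor> = \<lfloor>v\<rfloor> + 1)"
        if "v < of_int \<lfloor>u\<rfloor> + 1" "of_int \<lceil>u\<rceil> - 1 < v" for u v :: real
      proof -
        have "\<lfloor>v\<rfloor> \<le> \<lfloor>u\<rfloor>" "\<lceil>u\<rceil> - 1 \<le> \<lfloor>v\<rfloor>"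
          using that by linarith+
        then show ?thesis by linarith
      qed
      have x: "of_int ?x \<le> Re w \<and> Re w \<le> of_int ?x + 1" and x': "\<lfloor>Re w\<rfloor> \<in> {?x, ?x + 1}"
        and y: "of_int ?y \<le> Im w \<and> Im w \<le> of_int ?y + 1" and y': "\<lfloor>Im w\<rfloor> \<in> {?y, ?y + 1}"
        using *[of "Re w'" "Re w"] *[of "Im w'" "Im w"] a by simp_all
      then have "w \<in> plane_square (?x, ?y)"
        by (simp add: mem_plane_square)
      then have "(?x, ?y) \<notin> D"
        using w by (auto simp: plane_body_def)
      from height_corners_outside[OF t h this x' y'] show "H w = H w'"
        by (simp add: H_def)
    qed
  qed
  then have const: "H w = H w'" if "w \<in> - plane_body D" "w' \<in> - plane_body D" for w w'
    using connected_local_const[OF connected_complement_plane_body[OF D sc] that] by blast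
  have "finite ({v. h v \<noteq> 0} \<union> D)"
    using h D by (simp add: is_height_def)
  moreover have "infinite (UNIV :: (int \<times> int) set)"
    by (simp add: finite_prod)
  ultimately obtain q' where "h q' = 0" "q' \<notin> D"
    by (metis (mono_tags, lifting) UNIV_eq_I UnI1 UnI2 mem_Collect_eq)
  then have "h (x, y) = 0"
    using const[OF centre_out[OF q] centre_out[of q']] by (simp add: H_centre)
  then show ?thesis
    using height_corners_outside[OF t h q i j] by simp
qed

section \<open>Local moves\<close>

lemma tiling_pair: "domino d \<Longrightarrow> domino e \<Longrightarrow> disjnt d e \<Longrightarrow> d \<union> e = R \<Longrightarrow> tiling R {d, e}"
  by (auto simp: tiling_iff pairwise_insert disjnt_sym)

lemma tiling_boxes:
  "tiling (cell_box (x, y, z) (2, 2, 1)) {xdom x y z, xdom x (y + 1) z}"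
  "tiling (cell_box (x, y, z) (2, 2, 1)) {ydom x y z, ydom (x + 1) y z}"
  "tiling (cell_box (x, y, 0) (2, 1, 2)) {xdom x y 0, xdom x y 1}"
  "tiling (cell_box (x, y, 0) (2, 1, 2)) {zdom x y, zdom (x + 1) y}"
  "tiling (cell_box (x, y, 0) (1, 2, 2)) {ydom x y 0, ydom x y 1}"
  "tiling (cell_box (x, y, 0) (1, 2, 2)) {zdom x y, zdom x (y + 1)}"
  by (rule tiling_pair, simp, simp, force simp: mem_dom disjnt_def,
      auto simp: cell_box_cells mem_dom)+

text \<open>Both directions are demanded because the path from the second tiling to the common one
  is walked backwards in the end.\<close>

definition move :: "cell set \<Rightarrow> cell set set \<Rightarrow> cell set set \<Rightarrow> bool" where
  "move R t t' \<longleftrightarrow> (flip R t t' \<or> trit R t t') \<and> (flip R t' t \<or> trit R t' t)"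

lemma move_floor:
  assumes t: "tiling R t"
  shows "{xdom x y z, xdom x (y + 1) z} \<subseteq> t \<Longrightarrow>
      tiling R (t - {xdom x y z, xdom x (y + 1) z} \<union> {ydom x y z, ydom (x + 1) y z}) \<and>
      move R t (t - {xdom x y z, xdom x (y + 1) z} \<union> {ydom x y z, ydom (x + 1) y z})"
    and "{ydom x y z, ydom (x + 1) y z} \<subseteq> t \<Longrightarrow>
      tiling R (t - {ydom x y z, ydom (x + 1) y z} \<union> {xdom x y z, xdom x (y + 1) z}) \<and>
      move R t (t - {ydom x y z, ydom (x + 1) y z} \<union> {xdom x y z, xdom x (y + 1) z})"
  using flip_exchange[OF t _ tiling_boxes(1,2)] flip_exchange[OF t _ tiling_boxes(2,1)]
  unfolding move_def by (auto simp: doubleton_eq_iff)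

lemma move_jewels:
  assumes t: "tiling R t"
  shows "{xdom x y 0, xdom x y 1} \<subseteq> t \<Longrightarrow>
      tiling R (t - {xdom x y 0, xdom x y 1} \<union> {zdom x y, zdom (x + 1) y}) \<and>
      move R t (t - {xdom x y 0, xdom x y 1} \<union> {zdom x y, zdom (x + 1) y})"
    and "{ydom x y 0, ydom x y 1} \<subseteq> t \<Longrightarrow>
      tiling R (t - {ydom x y 0, ydom x y 1} \<union> {zdom x y, zdom x (y + 1)}) \<and>
      move R t (t - {ydom x y 0, ydom x y 1} \<union> {zdom x y, zdom x (y + 1)})"
  using flip_exchange[OF t _ tiling_boxes(3,4)] flip_exchange[OF t _ tiling_boxes(5,6)]
  unfolding move_def by (auto simp: doubleton_eq_iff)

lemma not_parallel_dom:
  "\<not> parallel (xdom x y z) (ydom x' y' z')" "\<not> parallel (ydom x' y' z') (xdom x y z)"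
  "\<not> parallel (xdom x y z) (zdom x' y')" "\<not> parallel (zdom x' y') (xdom x y z)"
  "\<not> parallel (ydom x y z) (zdom x' y')" "\<not> parallel (zdom x' y') (ydom x y z)"
  by (auto simp: parallel_def xdom_def ydom_def zdom_def doubleton_eq_iff)

text \<open>The block has corner \<open>(x, y)\<close>; the jewel moves between its lower right and its upper left
  square.\<close>

definition trit_below :: "int \<Rightarrow> int \<Rightarrow> int \<Rightarrow> cell set set" where
  "trit_below x y z = {zdom (x + 1) y, xdom x (y + 1) z, ydom x y (1 - z)}"

definition trit_above :: "int \<Rightarrow> int \<Rightarrow> int \<Rightarrow> cell set set" where
  "trit_above x y z = {zdom x (y + 1), ydom (x + 1) y z, xdom x y (1 - z)}"

lemma trit_blocks:
  assumes "z \<in> {0, 1}"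
  shows "\<Union>(trit_above x y z) = \<Union>(trit_below x y z)"
    "tiling (\<Union>(trit_below x y z)) (trit_above x y z)"
    "tiling (\<Union>(trit_above x y z)) (trit_below x y z)"
    "\<Union>(trit_below x y z) \<subseteq> cell_box (x, y, 0) (2, 2, 2)"
    "cell_box (x, y, 0) (2, 2, 2) - \<Union>(trit_below x y z) \<subseteq> {(x, y, z), (x + 1, y + 1, 1 - z)}"
    "card (trit_below x y z) = 3" "card (trit_above x y z) = 3"
    "pairwise (\<lambda>d e. \<not> parallel d e) (trit_below x y z)"
    "pairwise (\<lambda>d e. \<not> parallel d e) (trit_above x y z)"
    "trit_above x y z \<noteq> trit_below x y z"
proof -
  show U: "\<Union>(trit_above x y z) = \<Union>(trit_below x y z)"
    using assms by (auto simp: trit_above_def trit_below_def mem_dom)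
  have dom: "\<forall>d\<in>trit_above x y z. domino d" "\<forall>d\<in>trit_below x y z. domino d"
    by (auto simp: trit_above_def trit_below_def)
  have disj: "pairwise disjnt (trit_above x y z)" "pairwise disjnt (trit_below x y z)"
    using assms by (auto simp: trit_above_def trit_below_def pairwise_insert disjnt_def
        xdom_def ydom_def zdom_def)
  show "tiling (\<Union>(trit_below x y z)) (trit_above x y z)"
    "tiling (\<Union>(trit_above x y z)) (trit_below x y z)"
    unfolding tiling_iff using dom disj U by (simp_all only: simp_thms)
  have U_eq: "\<Union>(trit_below x y z) = {(x + 1, y, z), (x + 1, y, 1 - z), (x, y + 1, z), (x + 1, y + 1, z),
      (x, y, 1 - z), (x, y + 1, 1 - z)}"
    using assms by (elim insertE emptyE) (simp_all add: trit_below_def xdom_def ydom_def zdom_def, blast+)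
  have box_eq: "cell_box (x, y, 0) (2, 2, 2) = {(x, y, z), (x, y, 1 - z), (x + 1, y, z), (x + 1, y, 1 - z),
      (x, y + 1, z), (x, y + 1, 1 - z), (x + 1, y + 1, z), (x + 1, y + 1, 1 - z)}"
    using assms by (elim insertE emptyE) (simp_all add: cell_box_cells Sigma_def, blast+)
  show "\<Union>(trit_below x y z) \<subseteq> cell_box (x, y, 0) (2, 2, 2)"
    "cell_box (x, y, 0) (2, 2, 2) - \<Union>(trit_below x y z) \<subseteq> {(x, y, z), (x + 1, y + 1, 1 - z)}"
    unfolding U_eq box_eq by blast+
  show "card (trit_below x y z) = 3" "card (trit_above x y z) = 3"
    by (simp_all add: trit_below_def trit_above_def)
  show "pairwise (\<lambda>d e. \<not> parallel d e) (trit_below x y z)"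
    "pairwise (\<lambda>d e. \<not> parallel d e) (trit_above x y z)"
    by (auto simp: trit_below_def trit_above_def pairwise_insert not_parallel_dom)
  have "zdom x (y + 1) \<in> trit_above x y z" "zdom x (y + 1) \<notin> trit_below x y z"
    by (simp_all add: trit_below_def trit_above_def)
  then show "trit_above x y z \<noteq> trit_below x y z"
    by metis
qed

lemma move_trit:
  assumes t: "tiling R t" and z: "z \<in> {0, 1}" and S: "trit_below x y z \<subseteq> t"
  defines "t' \<equiv> t - trit_below x y z \<union> trit_above x y z"
  shows "tiling R t'" "move R t t'"
proof -
  note b = trit_blocks[OF z, of x y]
  have far: "\<not> share_face (x, y, z) (x + 1, y + 1, 1 - z)"
    by (auto simp: share_face_def)
  have 1: "trit R t t'" and t': "tiling R t'"
    unfolding t'_def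
    using trit_exchange[OF t S b(4) b(6) b(8) b(2) b(10) b(5) far] by blast+
  show "tiling R t'" by (rule t')
  have "trit_above x y z \<subseteq> t'"
    by (simp add: t'_def)
  from trit_exchange(2)[OF t' this _ b(7) b(9) b(3) _ _ far] have "trit R t' (t' - trit_above x y z \<union> trit_below x y z)"
    using b(4,5,10) by (simp add: b(1))
  also have "t' - trit_above x y z \<union> trit_below x y z = t"
    unfolding t'_def by (rule tiling_exchange(3)[OF t S b(2)])
  finally show "move R t t'"
    using 1 by (simp add: move_def)
qed

section \<open>Lowering the height\<close>

lemma is_heightD:
  assumes "is_height \<sigma> t h"
  shows "yflow \<sigma> t x (y - 1) = h (x, y) - h (x + 1, y)"
    "xflow \<sigma> t (x - 1) y = h (x, y + 1) - h (x, y)"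
    "yflow \<sigma> t x y = h (x, y + 1) - h (x + 1, y + 1)"
    "xflow \<sigma> t x y = h (x + 1, y + 1) - h (x + 1, y)"
proof -
  have 1: "yflow \<sigma> t x (y - 1) = h (x, y) - h (x + 1, y)"
    and 2: "xflow \<sigma> t (x - 1) y = h (x, y + 1) - h (x, y)" for x y
    using assms by (simp_all add: is_height_def)
  show "yflow \<sigma> t x (y - 1) = h (x, y) - h (x + 1, y)"
    "xflow \<sigma> t (x - 1) y = h (x, y + 1) - h (x, y)" by (rule 1 2)+
  show "yflow \<sigma> t x y = h (x, y + 1) - h (x + 1, y + 1)"
    "xflow \<sigma> t x y = h (x + 1, y + 1) - h (x + 1, y)"
    using 1[of x "y + 1"] 2[of "x + 1" y] by simp_all
qed

text \<open>The flow changes by a unit circulation, clockwise through the four squares that meet at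
  the vertex \<open>(x, y)\<close>. It winds once around this vertex and around no other.\<close>

lemma is_height_lower:
  assumes h: "is_height \<sigma> t h"
    and X: "\<And>i j. xflow \<sigma> t' i j = xflow \<sigma> t i j
      + of_bool (i = x - 1 \<and> j = y) - of_bool (i = x - 1 \<and> j = y - 1)"
    and Y: "\<And>i j. yflow \<sigma> t' i j = yflow \<sigma> t i j
      - of_bool (i = x \<and> j = y - 1) + of_bool (i = x - 1 \<and> j = y - 1)"
  shows "is_height \<sigma> t' (h((x, y) := h (x, y) - 1))"
proof -
  let ?h = "\<lambda>v. h v - of_bool (v = (x, y))"
  have eq: "h((x, y) := h (x, y) - 1) = ?h"
    by auto
  have "{v. ?h v \<noteq> 0} \<subseteq> insert (x, y) {v. h v \<noteq> 0}"
    by auto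
  then have "finite {v. ?h v \<noteq> 0}"
    by (rule finite_subset) (use h in \<open>simp add: is_height_def\<close>)
  moreover have "?h (i + 1, j) = ?h (i, j) - yflow \<sigma> t' i (j - 1)" for i j
    using is_heightD(1)[OF h, of i j] Y[of i "j - 1"]
    by (cases "i = x"; cases "i = x - 1"; cases "j = y") simp_all
  moreover have "?h (i, j + 1) = ?h (i, j) + xflow \<sigma> t' (i - 1) j" for i j
    using is_heightD(2)[OF h, of i j] X[of "i - 1" j]
    by (cases "i = x"; cases "j = y"; cases "j = y - 1") simp_all
  ultimately show ?thesis
    unfolding is_height_def eq by blast
qed

lemma unit_flow:
  assumes "\<sigma> \<in> {1, -1}"
  shows "xflow \<sigma> t x y = 1 \<or> xflow \<sigma> t x y = - 1 \<Longrightarrow>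
      \<exists>z\<in>{0, 1}. xdom x y z \<in> t \<and> xdom x y (1 - z) \<notin> t \<and> weight \<sigma> (x, y, z) = xflow \<sigma> t x y"
    and "yflow \<sigma> t x y = 1 \<or> yflow \<sigma> t x y = - 1 \<Longrightarrow>
      \<exists>z\<in>{0, 1}. ydom x y z \<in> t \<and> ydom x y (1 - z) \<notin> t \<and> weight \<sigma> (x, y, z) = yflow \<sigma> t x y"
  by (auto simp: xflow_eq yflow_eq weight_neighbour(5) of_bool_def split: if_splits)

lemma flow_bounds:
  assumes "\<sigma> \<in> {1, -1}"
  shows "\<bar>xflow \<sigma> t x y\<bar> \<le> 1" "\<bar>yflow \<sigma> t x y\<bar> \<le> 1"
  using assms by (auto simp: xflow_eq yflow_eq weight_def)

lemma weight_unit: "\<sigma> \<in> {1, -1} \<Longrightarrow> weight \<sigma> c \<in> {1, -1}"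
  by (auto simp: weight_def)

lemma weight_inj: "\<sigma> \<in> {1, -1} \<Longrightarrow> z \<in> {0, 1} \<Longrightarrow> z' \<in> {0, 1} \<Longrightarrow>
    weight \<sigma> (x, y, z) = weight \<sigma> (x, y, z') \<longleftrightarrow> z = z'"
  by (auto simp: weight_def white_def)

section \<open>The effect of single moves on the flow and the height\<close>

lemma flow_exchange:
  assumes "p \<subseteq> t" "(t - p) \<inter> p' = {}"
  shows "xflow \<sigma> (t - p \<union> p') i j = xflow \<sigma> t i j - xflow \<sigma> p i j + xflow \<sigma> p' i j"
    "yflow \<sigma> (t - p \<union> p') i j = yflow \<sigma> t i j - yflow \<sigma> p i j + yflow \<sigma> p' i j"
proof -
  have eq: "of_bool (d \<in> t - p \<union> p') = (of_bool (d \<in> t) - of_bool (d \<in> p) + of_bool (d \<in> p') :: int)" for d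
    using assms by auto
  show "xflow \<sigma> (t - p \<union> p') i j = xflow \<sigma> t i j - xflow \<sigma> p i j + xflow \<sigma> p' i j"
    "yflow \<sigma> (t - p \<union> p') i j = yflow \<sigma> t i j - yflow \<sigma> p i j + yflow \<sigma> p' i j"
    unfolding xflow_eq yflow_eq eq by (simp_all only: algebra_simps)
qed

lemma flow_insert:
  "xflow \<sigma> {} i j = 0" "yflow \<sigma> {} i j = 0"
  "z \<in> {0, 1} \<Longrightarrow> xdom a b z \<notin> p \<Longrightarrow>
    xflow \<sigma> (insert (xdom a b z) p) i j = weight \<sigma> (a, b, z) * of_bool (i = a \<and> j = b) + xflow \<sigma> p i j"
  "z \<in> {0, 1} \<Longrightarrow> ydom a b z \<notin> p \<Longrightarrow>
    yflow \<sigma> (insert (ydom a b z) p) i j = weight \<sigma> (a, b, z) * of_bool (i = a \<and> j = b) + yflow \<sigma> p i j"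
  "xflow \<sigma> (insert (ydom a b z) p) i j = xflow \<sigma> p i j"
  "xflow \<sigma> (insert (zdom a b) p) i j = xflow \<sigma> p i j"
  "yflow \<sigma> (insert (xdom a b z) p) i j = yflow \<sigma> p i j"
  "yflow \<sigma> (insert (zdom a b) p) i j = yflow \<sigma> p i j"
  by (auto simp: xflow_eq yflow_eq weight_neighbour(5))

lemma tiling_exchange_disjoint:
  "tiling R t \<Longrightarrow> p \<subseteq> t \<Longrightarrow> tiling (\<Union>p) p' \<Longrightarrow> (t - p) \<inter> p' = {}"
  using tiling_exchange(2)[of R t p p'] by blast

text \<open>On one floor the cubes of neighbouring columns have opposite colours, so opposite flows
  must come from the same floor. The two dominoes then fill a box of that floor and can be
  flipped.\<close>

lemma lower_vertical:
  assumes t: "tiling R t" and \<sigma>: "\<sigma> \<in> {1, -1}" and h: "is_height \<sigma> t h"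
    and f: "yflow \<sigma> t x (y - 1) = 1" "yflow \<sigma> t (x - 1) (y - 1) = - 1"
  shows "\<exists>t'. move R t t' \<and> tiling R t' \<and> is_height \<sigma> t' (h((x, y) := h (x, y) - 1))"
proof -
  obtain z where z: "z \<in> {0, 1}" "ydom x (y - 1) z \<in> t" "weight \<sigma> (x, y - 1, z) = 1"
    using unit_flow(2)[OF \<sigma>, of t x "y - 1"] f by auto
  obtain z' where z': "z' \<in> {0, 1}" "ydom (x - 1) (y - 1) z' \<in> t" "weight \<sigma> (x - 1, y - 1, z') = - 1"
    using unit_flow(2)[OF \<sigma>, of t "x - 1" "y - 1"] f by auto
  have "z' = z"
    using weight_inj[OF \<sigma> z'(1) z(1), of x "y - 1"] z z' by (simp add: weight_neighbour)
  let ?p = "{ydom (x - 1) (y - 1) z, ydom x (y - 1) z}"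
  let ?p' = "{xdom (x - 1) (y - 1) z, xdom (x - 1) y z}"
  have p: "?p \<subseteq> t" using z z' \<open>z' = z\<close> by simp
  have "tiling (\<Union>?p) ?p'"
    using tiling_boxes(1,2)[of "x - 1" "y - 1" z] by (auto simp: tiling_iff)
  note ex = flow_exchange[OF p tiling_exchange_disjoint[OF t p this], of \<sigma>]
  have w: "weight \<sigma> (x - 1, y - 1, z) = - 1" "weight \<sigma> (x - 1, y, z) = 1"
    using z weight_neighbour(2)[of \<sigma> x "y - 1" z] by (simp_all add: weight_neighbour)
  have "is_height \<sigma> (t - ?p \<union> ?p') (h((x, y) := h (x, y) - 1))"
    by (rule is_height_lower[OF h]; unfold ex; use z(1) w z(3) in \<open>simp add: flow_insert\<close>)
  moreover have "tiling R (t - ?p \<union> ?p')" "move R t (t - ?p \<union> ?p')"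
    using move_floor(2)[OF t, of "x - 1" "y - 1" z] p by simp_all
  ultimately show ?thesis by blast
qed

lemma lower_horizontal:
  assumes t: "tiling R t" and \<sigma>: "\<sigma> \<in> {1, -1}" and h: "is_height \<sigma> t h"
    and f: "xflow \<sigma> t (x - 1) y = - 1" "xflow \<sigma> t (x - 1) (y - 1) = 1"
  shows "\<exists>t'. move R t t' \<and> tiling R t' \<and> is_height \<sigma> t' (h((x, y) := h (x, y) - 1))"
proof -
  obtain z where z: "z \<in> {0, 1}" "xdom (x - 1) y z \<in> t" "weight \<sigma> (x - 1, y, z) = - 1"
    using unit_flow(1)[OF \<sigma>, of t "x - 1" y] f by auto
  obtain z' where z': "z' \<in> {0, 1}" "xdom (x - 1) (y - 1) z' \<in> t" "weight \<sigma> (x - 1, y - 1, z') = 1"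
    using unit_flow(1)[OF \<sigma>, of t "x - 1" "y - 1"] f by auto
  have "z' = z"
    using weight_inj[OF \<sigma> z'(1) z(1), of "x - 1" y] z z' by (simp add: weight_neighbour)
  let ?p = "{xdom (x - 1) (y - 1) z, xdom (x - 1) y z}"
  let ?p' = "{ydom (x - 1) (y - 1) z, ydom x (y - 1) z}"
  have p: "?p \<subseteq> t" using z z' \<open>z' = z\<close> by simp
  have "tiling (\<Union>?p) ?p'"
    using tiling_boxes(1,2)[of "x - 1" "y - 1" z] by (auto simp: tiling_iff)
  note ex = flow_exchange[OF p tiling_exchange_disjoint[OF t p this], of \<sigma>]
  have w: "weight \<sigma> (x - 1, y - 1, z) = 1" "weight \<sigma> (x, y - 1, z) = - 1"
    using z' \<open>z' = z\<close> weight_neighbour(1)[of \<sigma> "x - 1" "y - 1" z] by simp_all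
  have "is_height \<sigma> (t - ?p \<union> ?p') (h((x, y) := h (x, y) - 1))"
    by (rule is_height_lower[OF h]; unfold ex; use z(1) w z(3) in \<open>simp add: flow_insert\<close>)
  moreover have "tiling R (t - ?p \<union> ?p')" "move R t (t - ?p \<union> ?p')"
    using move_floor(1)[OF t, of "x - 1" "y - 1" z] p by simp_all
  ultimately show ?thesis by blast
qed

text \<open>Equal flows at neighbouring squares come from different floors, by the colours. Two such
  dominoes that meet over a square, together with the jewel diagonally opposite, are the pattern of
  a trit.\<close>

lemma lower_corner:
  assumes t: "tiling R t" and \<sigma>: "\<sigma> \<in> {1, -1}" and h: "is_height \<sigma> t h"
    and f: "xflow \<sigma> t (x - 1) y = - 1" "yflow \<sigma> t (x - 1) (y - 1) = - 1" and j: "zdom x (y - 1) \<in> t"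
  shows "\<exists>t'. move R t t' \<and> tiling R t' \<and> is_height \<sigma> t' (h((x, y) := h (x, y) - 1))"
proof -
  obtain z where z: "z \<in> {0, 1}" "xdom (x - 1) y z \<in> t" "weight \<sigma> (x - 1, y, z) = - 1"
    using unit_flow(1)[OF \<sigma>, of t "x - 1" y] f by auto
  obtain z' where z': "z' \<in> {0, 1}" "ydom (x - 1) (y - 1) z' \<in> t" "weight \<sigma> (x - 1, y - 1, z') = - 1"
    using unit_flow(2)[OF \<sigma>, of t "x - 1" "y - 1"] f by auto
  have "weight \<sigma> (x - 1, y, z') \<noteq> weight \<sigma> (x - 1, y, z)"
    using z(3) z'(3) by (simp add: weight_neighbour)
  then have "z' \<noteq> z" by blast
  then have z'_eq: "z' = 1 - z" using z(1) z'(1) by auto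
  let ?p = "trit_below (x - 1) (y - 1) z" and ?p' = "trit_above (x - 1) (y - 1) z"
  have p: "?p \<subseteq> t" using z z' j by (simp add: trit_below_def z'_eq)
  note ex = flow_exchange[OF p tiling_exchange_disjoint[OF t p trit_blocks(2)[OF z(1)]], of \<sigma>]
  have zb: "1 - z \<in> {0, 1}" using z(1) by auto
  have w: "weight \<sigma> (x - 1, y - 1, 1 - z) = - 1" "weight \<sigma> (x, y - 1, z) = - 1"
    using z z' weight_neighbour(1)[of \<sigma> "x - 1" "y - 1" z] by (simp_all add: z'_eq weight_neighbour)
  have "is_height \<sigma> (t - ?p \<union> ?p') (h((x, y) := h (x, y) - 1))"
    by (rule is_height_lower[OF h]; unfold ex;
        use z(1) zb w z(3) in \<open>simp add: flow_insert trit_below_def trit_above_def\<close>)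
  then show ?thesis
    using move_trit[OF t z(1) p] by blast
qed

text \<open>Zero net flow across an edge means that both floors have a domino there or neither.
  Flipping such a stacked pair to jewels changes no flow, as its two contributions cancel. That old
  jewels survive is needed for the termination of \<open>reach_vertical\<close>.\<close>

lemma make_jewel:
  assumes t: "tiling (prism D) t" and \<sigma>: "\<sigma> \<in> {1, -1}" and h: "is_height \<sigma> t h" and q: "(x, y) \<in> D"
    and f: "xflow \<sigma> t x y = 0" "xflow \<sigma> t (x - 1) y = 0" "yflow \<sigma> t x y = 0" "yflow \<sigma> t x (y - 1) = 0"
  shows "\<exists>t'. (move (prism D))\<^sup>*\<^sup>* t t' \<and> tiling (prism D) t' \<and> is_height \<sigma> t' h \<and> zdom x y \<in> t' \<and>
     (\<forall>i j. zdom i j \<in> t \<longrightarrow> zdom i j \<in> t')"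
proof (cases "zdom x y \<in> t")
  case True
  then show ?thesis using t h by blast
next
  case False
  have both_x: "{xdom i j 0, xdom i j 1} \<subseteq> t" if "xflow \<sigma> t i j = 0" "xdom i j 0 \<in> t" for i j
    using that weight_unit[OF \<sigma>, of "(i, j, 0)"] by (auto simp: xflow_eq of_bool_def split: if_splits)
  have both_y: "{ydom i j 0, ydom i j 1} \<subseteq> t" if "yflow \<sigma> t i j = 0" "ydom i j 0 \<in> t" for i j
    using that weight_unit[OF \<sigma>, of "(i, j, 0)"] by (auto simp: yflow_eq of_bool_def split: if_splits)
  have done_x: ?thesis if "xflow \<sigma> t i j = 0" "xdom i j 0 \<in> t" "i = x \<and> j = y \<or> i + 1 = x \<and> j = y" for i j
  proof -
    let ?p = "{xdom i j 0, xdom i j 1}" and ?p' = "{zdom i j, zdom (i + 1) j}"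
    have p: "?p \<subseteq> t" by (rule both_x[OF that(1,2)])
    have "tiling (\<Union>?p) ?p'"
      using tiling_boxes(3,4)[of i j] by (auto simp: tiling_iff)
    note ex = flow_exchange[OF p tiling_exchange_disjoint[OF t p this], of \<sigma>]
    have "xflow \<sigma> (t - ?p \<union> ?p') k l = xflow \<sigma> t k l \<and> yflow \<sigma> (t - ?p \<union> ?p') k l = yflow \<sigma> t k l" for k l
      unfolding ex by (simp add: xflow_eq yflow_eq)
    then have "is_height \<sigma> (t - ?p \<union> ?p') h"
      using h by (simp add: is_height_def)
    moreover have "zdom x y \<in> t - ?p \<union> ?p'" "\<forall>i j. zdom i j \<in> t \<longrightarrow> zdom i j \<in> t - ?p \<union> ?p'"
      using that(3) by auto
    ultimately show ?thesis
      using move_jewels(1)[OF t p] by blast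
  qed
  have done_y: ?thesis if "yflow \<sigma> t i j = 0" "ydom i j 0 \<in> t" "i = x \<and> j = y \<or> i = x \<and> j + 1 = y" for i j
  proof -
    let ?p = "{ydom i j 0, ydom i j 1}" and ?p' = "{zdom i j, zdom i (j + 1)}"
    have p: "?p \<subseteq> t" by (rule both_y[OF that(1,2)])
    have "tiling (\<Union>?p) ?p'"
      using tiling_boxes(5,6)[of i j] by (auto simp: tiling_iff)
    note ex = flow_exchange[OF p tiling_exchange_disjoint[OF t p this], of \<sigma>]
    have "xflow \<sigma> (t - ?p \<union> ?p') k l = xflow \<sigma> t k l \<and> yflow \<sigma> (t - ?p \<union> ?p') k l = yflow \<sigma> t k l" for k l
      unfolding ex by (simp add: xflow_eq yflow_eq)
    then have "is_height \<sigma> (t - ?p \<union> ?p') h"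
      using h by (simp add: is_height_def)
    moreover have "zdom x y \<in> t - ?p \<union> ?p'" "\<forall>i j. zdom i j \<in> t \<longrightarrow> zdom i j \<in> t - ?p \<union> ?p'"
      using that(3) by auto
    ultimately show ?thesis
      using move_jewels(2)[OF t p] by blast
  qed
  have "xdom x y 0 \<in> t \<or> xdom (x - 1) y 0 \<in> t \<or> ydom x y 0 \<in> t \<or> ydom x (y - 1) 0 \<in> t"
    using horizontal_count[OF t, of 0 x y] q False by (auto simp: of_bool_def split: if_splits)
  then show ?thesis
    using done_x[OF f(1)] done_x[OF f(2)] done_y[OF f(3)] done_y[OF f(4)] by auto
qed

section \<open>Connectivity of duplex regions\<close>

lemma lower_height:
  assumes t: "tiling (prism D) t" and \<sigma>: "\<sigma> \<in> {1, -1}" and h: "is_height \<sigma> t h"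
    and D: "finite D" "simply_connected (plane_body D)" and pos: "h v\<^sub>0 > 0"
  shows "\<exists>t' v. (move (prism D))\<^sup>*\<^sup>* t t' \<and> tiling (prism D) t' \<and> h v > 0 \<and> is_height \<sigma> t' (h(v := h v - 1))"
proof -
  have fin: "finite {v. h v \<noteq> 0}"
    using h by (simp add: is_height_def)
  define m where "m = Max (h ` {v. h v \<noteq> 0})"
  have "v\<^sub>0 \<in> {v. h v \<noteq> 0}" using pos by simp
  have fin': "finite (h ` {v. h v \<noteq> 0})" using fin by simp
  have le0: "h v \<le> m" if "h v \<noteq> 0" for v
    unfolding m_def using that by (intro Max_ge fin') simp
  have m: "m > 0" using le0[of v\<^sub>0] pos by linarith
  have le: "h v \<le> m" for v
    using le0[of v] m by (cases "h v = 0") auto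
  define A where "A = {v. h v = m}"
  have A: "finite A"
    unfolding A_def by (rule finite_subset[OF _ fin]) (use m in auto)
  have "m \<in> h ` {v. h v \<noteq> 0}"
    unfolding m_def by (rule Max_in[OF fin']) (use \<open>v\<^sub>0 \<in> {v. h v \<noteq> 0}\<close> in blast)
  then have "A \<noteq> {}" by (auto simp: A_def)
  define y where "y = Max (snd ` A)"
  have y_max: "b \<le> y" if "h (a, b) = m" for a b
    unfolding y_def using A that by (intro Max_ge) (auto simp: A_def rev_image_eqI)
  have "y \<in> snd ` A"
    unfolding y_def using A \<open>A \<noteq> {}\<close> by (intro Max_in) auto
  then have ne: "{a. h (a, y) = m} \<noteq> {}" by (auto simp: A_def)
  have fin_row: "finite {a. h (a, y) = m}"
    by (rule finite_subset[of _ "fst ` A"]) (use A in \<open>auto simp: A_def rev_image_eqI\<close>)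
  define x where "x = Min {a. h (a, y) = m}"
  have hm: "h (x, y) = m"
    using Min_in[OF fin_row ne] by (simp add: x_def)
  have x_min: "x \<le> a" if "h (a, y) = m" for a
    unfolding x_def using that by (intro Min_le fin_row) simp
  have above: "h (a, y + 1) < m" for a
    using y_max[of a "y + 1"] le[of "(a, y + 1)"] by force
  have left: "h (x - 1, y) < m"
    using x_min[of "x - 1"] le[of "(x - 1, y)"] by force
  note f = is_heightD[OF h]
  \<comment> \<open>A strictly lower neighbour and the unit bound on flows determine the flow
    exactly. \<open>N\<close>, \<open>W\<close>, \<open>S\<close> and \<open>E\<close> name the side
    on which the lower neighbour lies.\<close>
  have N: "xflow \<sigma> t (a - 1) y = - 1" if "h (a, y) = m" for a
    using f(2)[of a y] above[of a] flow_bounds(1)[OF \<sigma>, of t "a - 1" y] that by linarith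
  have W: "yflow \<sigma> t (x - 1) (y - 1) = - 1"
    using f(1)[of "x - 1" y] left hm flow_bounds(2)[OF \<sigma>, of t "x - 1" "y - 1"] by simp
  have S: "xflow \<sigma> t (a - 1) (y - 1) = 1" if "h (a, y) = m" "h (a, y - 1) \<noteq> m" for a
    using f(2)[of a "y - 1"] le[of "(a, y - 1)"] that flow_bounds(1)[OF \<sigma>, of t "a - 1" "y - 1"] by simp
  have E: "yflow \<sigma> t x (y - 1) = 1" if "h (x + 1, y) \<noteq> m"
    using f(1)[of x y] le[of "(x + 1, y)"] that hm flow_bounds(2)[OF \<sigma>, of t x "y - 1"] by simp
  consider "h (x + 1, y) \<noteq> m" | "h (x, y - 1) \<noteq> m" | "h (x + 1, y) = m" "h (x + 1, y - 1) \<noteq> m"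
    | "h (x + 1, y) = m" "h (x, y - 1) = m" "h (x + 1, y - 1) = m"
    by blast
  then show ?thesis
  proof cases
    case 1
    then show ?thesis
      using lower_vertical[OF t \<sigma> h E W] hm m by blast
  next
    case 2
    then show ?thesis
      using lower_horizontal[OF t \<sigma> h N[OF hm] S[OF hm]] hm m by blast
  next
    \<comment> \<open>The pinched corner: the right neighbour is again a maximum of the top row, but
      the vertex below it is not, so that \<open>(x + 1, y)\<close> can be lowered.\<close>
    case 3
    then show ?thesis
      using lower_horizontal[OF t \<sigma> h N[OF 3(1)] S[OF 3]] m by (metis r_into_rtranclp)
  next
    \<comment> \<open>All corners of the square \<open>(x, y - 1)\<close> have height
      \<open>m\<close>, hence its four flows vanish. Creating a jewel there keeps the height, and
      with it the two flows at \<open>(x, y)\<close> that the trit needs.\<close>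
    case 4
    have "(x, y - 1) \<in> D"
      using height_zero_outside[OF t h _ D, of x "y - 1" x y] hm m by auto
    moreover have "xflow \<sigma> t x (y - 1) = 0" "xflow \<sigma> t (x - 1) (y - 1) = 0"
      "yflow \<sigma> t x (y - 1) = 0" "yflow \<sigma> t x (y - 1 - 1) = 0"
      using f(4)[of x "y - 1"] f(2)[of x "y - 1"] f(3)[of x "y - 1"] f(1)[of x "y - 1"] hm 4 by simp_all
    ultimately obtain t' where t': "(move (prism D))\<^sup>*\<^sup>* t t'" "tiling (prism D) t'" "is_height \<sigma> t' h"
        "zdom x (y - 1) \<in> t'"
      using make_jewel[OF t \<sigma> h] by blast
    have "xflow \<sigma> t' (x - 1) y = - 1" "yflow \<sigma> t' (x - 1) (y - 1) = - 1"
      using N[OF hm] W f(2)[of x y] is_heightD(2)[OF t'(3), of x y]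
        f(1)[of "x - 1" y] is_heightD(1)[OF t'(3), of "x - 1" y] by simp_all
    from lower_corner[OF t'(2) \<sigma> t'(3) this t'(4)] show ?thesis
      using t'(1) hm m by (metis rtranclp.rtrancl_into_rtrancl)
  qed
qed

text \<open>The sum of the absolute heights decreases. Negative heights become positive by reversing
  \<sigma>, which amounts to exchanging the colours.\<close>

lemma reach_height_zero:
  assumes "tiling (prism D) t" "\<sigma> \<in> {1, -1}" "is_height \<sigma> t h"
    and D: "finite D" "simply_connected (plane_body D)"
  shows "\<exists>t'. (move (prism D))\<^sup>*\<^sup>* t t' \<and> tiling (prism D) t' \<and> is_height 1 t' (\<lambda>_. 0)"
  using assms(1-3)
proof (induction "\<Sum>v | h v \<noteq> 0. nat \<bar>h v\<bar>" arbitrary: t \<sigma> h rule: less_induct)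
  case less
  \<comment> \<open>Here \<open>g\<close> is \<open>h\<close> or its negative, so that a nonzero
    height of either sign yields a positive value to lower.\<close>
  have step: ?case if t: "tiling (prism D) t" and \<sigma>: "\<sigma> \<in> {1, -1}" and h: "is_height \<sigma> t g"
    and g: "\<And>v. \<bar>g v\<bar> = \<bar>h v\<bar>" and pos: "g v > 0" for \<sigma> g v
  proof -
    obtain t' v where t': "(move (prism D))\<^sup>*\<^sup>* t t'" "tiling (prism D) t'" "g v > 0"
        "is_height \<sigma> t' (g(v := g v - 1))"
      using lower_height[OF t \<sigma> h D pos] by blast
    let ?g = "g(v := g v - 1)" and ?K = "{v. h v \<noteq> 0}"
    have K: "finite ?K" using less.prems by (simp add: is_height_def)
    have gh: "g w = 0 \<longleftrightarrow> h w = 0" for w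
      using g[of w] by (metis abs_eq_0)
    have hv: "h v \<noteq> 0"
      using t'(3) gh[of v] by simp
    have "(\<Sum>w | ?g w \<noteq> 0. nat \<bar>?g w\<bar>) \<le> (\<Sum>w\<in>?K. nat \<bar>?g w\<bar>)"
      using hv by (intro sum_mono2[OF K]) (auto simp: gh split: if_splits)
    also have "\<dots> < (\<Sum>w\<in>?K. nat \<bar>h w\<bar>)"
    proof (rule sum_strict_mono_ex1[OF K])
      show "\<forall>w\<in>?K. nat \<bar>?g w\<bar> \<le> nat \<bar>h w\<bar>"
        using t'(3) by (auto simp flip: g)
      show "\<exists>w\<in>?K. nat \<bar>?g w\<bar> < nat \<bar>h w\<bar>"
        using t'(3) hv by (intro bexI[of _ v]) (auto simp flip: g)
    qed
    finally show ?thesis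
      using less.hyps[OF _ t'(2) \<sigma> t'(4)] t'(1) by (meson rtranclp_trans)
  qed
  show ?case
  proof (cases "\<exists>v. h v \<noteq> 0")
    case True
    then obtain v where "h v \<noteq> 0" by blast
    then have "h v > 0 \<or> - h v > 0" by linarith
    then show ?thesis
      using step[OF less.prems] step[OF less.prems(1) _ is_height_uminus[OF less.prems(3)]] less.prems(2)
      by (metis abs_minus_cancel insert_iff minus_minus singletonD)
  next
    case False
    then have h: "h = (\<lambda>_. 0)" by auto
    then have "is_height 1 t (\<lambda>_. 0)"
      using less.prems(2,3) is_height_uminus[of \<sigma> t h] by auto
    then show ?thesis using less.prems(1) by blast
  qed
qed

text \<open>With zero height all flows vanish, so every square that is not yet a jewel can be made
  one; the number of missing jewels decreases.\<close>

lemma reach_vertical: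
  assumes "tiling (prism D) t" "is_height 1 t (\<lambda>_. 0)" and D: "finite D"
  shows "(move (prism D))\<^sup>*\<^sup>* t ((\<lambda>(x, y). zdom x y) ` D)"
  using assms(1,2)
proof (induction "card {q \<in> D. (\<lambda>(x, y). zdom x y) q \<notin> t}" arbitrary: t rule: less_induct)
  case less
  show ?case
  proof (cases "\<exists>x y. (x, y) \<in> D \<and> zdom x y \<notin> t")
    case True
    then obtain x y where q: "(x, y) \<in> D" "zdom x y \<notin> t" by blast
    have "xflow 1 t i j = 0" "yflow 1 t i j = 0" for i j
      using is_heightD(3,4)[OF less.prems(2)] by simp_all
    then obtain t' where t': "(move (prism D))\<^sup>*\<^sup>* t t'" "tiling (prism D) t'" "is_height 1 t' (\<lambda>_. 0)"
        "zdom x y \<in> t'" "\<forall>i j. zdom i j \<in> t \<longrightarrow> zdom i j \<in> t'"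
      using make_jewel[OF less.prems(1) _ less.prems(2) q(1)] by auto
    have "{q \<in> D. (\<lambda>(x, y). zdom x y) q \<notin> t'} \<subset> {q \<in> D. (\<lambda>(x, y). zdom x y) q \<notin> t}"
    proof (rule psubsetI)
      show "{q \<in> D. (\<lambda>(x, y). zdom x y) q \<notin> t'} \<subseteq> {q \<in> D. (\<lambda>(x, y). zdom x y) q \<notin> t}"
        using t'(5) by auto
      have "(x, y) \<in> {q \<in> D. (\<lambda>(x, y). zdom x y) q \<notin> t}" "(x, y) \<notin> {q \<in> D. (\<lambda>(x, y). zdom x y) q \<notin> t'}"
        using q t'(4) by auto
      then show "{q \<in> D. (\<lambda>(x, y). zdom x y) q \<notin> t'} \<noteq> {q \<in> D. (\<lambda>(x, y). zdom x y) q \<notin> t}"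
        by metis
    qed
    then have "card {q \<in> D. (\<lambda>(x, y). zdom x y) q \<notin> t'} < card {q \<in> D. (\<lambda>(x, y). zdom x y) q \<notin> t}"
      using D by (intro psubset_card_mono) auto
    then show ?thesis
      using less.hyps[OF _ t'(2,3)] t'(1) by (meson rtranclp_trans)
  next
    case False
    have "d \<in> (\<lambda>(x, y). zdom x y) ` D" if d: "d \<in> t" for d
    proof -
      obtain x y z where c: "(x, y, z) \<in> d"
        using domino_nonempty[OF tiling_domino[OF less.prems(1) d]] by (metis ex_in_conv prod_cases3)
      then have xyz: "(x, y) \<in> D" "z \<in> {0, 1}"
        using tiling_subset[OF less.prems(1) d] by (auto simp: prism_def)
      then have "zdom x y \<in> t" "(x, y, z) \<in> zdom x y"
        using False by (auto simp: mem_zdom)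
      then have "d = zdom x y"
        using tiling_unique[OF less.prems(1) d _ c] by blast
      then show ?thesis using xyz by auto
    qed
    then have "t = (\<lambda>(x, y). zdom x y) ` D"
      using False by auto
    then show ?thesis by simp
  qed
qed

lemma move_sym: "move R t t' \<Longrightarrow> move R t' t"
  by (auto simp: move_def)

theorem duplex_connected:
  assumes R: "duplex R" and t: "tiling R t\<^sub>0" "tiling R t\<^sub>1"
  shows "(\<lambda>t t'. flip R t t' \<or> trit R t t')\<^sup>*\<^sup>* t\<^sub>0 t\<^sub>1"
proof -
  obtain D where D: "finite D" "simply_connected (plane_body D)" and R_eq: "R = prism D"
    using R by (auto simp: duplex_def prism_def)
  have reach: "(move R)\<^sup>*\<^sup>* t ((\<lambda>(x, y). zdom x y) ` D)" if t: "tiling R t" for t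
  proof -
    obtain h where "is_height 1 t h"
      using height_exists[of D t] t D R_eq by blast
    then obtain t' where "(move R)\<^sup>*\<^sup>* t t'" "tiling R t'" "is_height 1 t' (\<lambda>_. 0)"
      using reach_height_zero[of D t 1 h] t D R_eq by auto
    then show ?thesis
      using reach_vertical[of D t'] D(1) R_eq by (metis rtranclp_trans)
  qed
  have "symp (move R)" using move_sym by (auto intro: sympI)
  then have "(move R)\<^sup>*\<^sup>* t\<^sub>0 t\<^sub>1"
    using reach[OF t(1)] reach[OF t(2)] by (metis rtranclp_trans symp_rtranclp sympD)
  then show ?thesis
    by (rule rtranclp_mono[THEN predicate2D, rotated]) (auto simp: move_def)
qed

section \<open>Winding numbers of closed systems of arcs\<close>

text \<open>Reads a product of disjoint cycles as lists in which \<open>p\<close> leads to the next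
  entry, cyclically. The decomposition may contain empty cycles; they are dropped because a closed
  chain is nonempty.\<close>

lemma cycle_decomp_lists:
  assumes "cycle_decomp I p"
  shows "(\<forall>x. x \<notin> I \<longrightarrow> p x = x) \<and> (\<exists>L. distinct (concat L) \<and> set (concat L) = I \<and>
    (\<forall>cs\<in>set L. cs \<noteq> [] \<and> (\<forall>i<length cs. p (cs ! i) = cs ! (Suc i mod length cs))))"
  using assms
proof induction
  case empty
  show ?case by (auto intro: exI[of _ "[]"])
next
  case (comp I p cs)
  from comp.IH obtain L where fix_p: "\<And>x. x \<notin> I \<Longrightarrow> p x = x"
      and L: "distinct (concat L)" "set (concat L) = I"
        "\<And>ds i. ds \<in> set L \<Longrightarrow> ds \<noteq> []"
        "\<And>ds i. ds \<in> set L \<Longrightarrow> i < length ds \<Longrightarrow> p (ds ! i) = ds ! (Suc i mod length ds)"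
    by blast
  have rot: "cycle_of_list cs (cs ! i) = cs ! (Suc i mod length cs)" if "i < length cs" for i
  proof -
    have "map (cycle_of_list cs) cs ! i = rotate1 cs ! i"
      using cyclic_rotation[OF comp.hyps(2), of 1] by simp
    then show ?thesis using that by (simp add: nth_rotate1)
  qed
  have out: "\<forall>x. x \<notin> set cs \<union> I \<longrightarrow> (cycle_of_list cs \<circ> p) x = x"
    using fix_p id_outside_supp[of _ cs] by simp
  have old: "(cycle_of_list cs \<circ> p) (ds ! i) = ds ! (Suc i mod length ds)"
    if "ds \<in> set L" "i < length ds" for ds i
  proof -
    have "ds ! (Suc i mod length ds) \<in> set ds"
      using that by (intro nth_mem mod_less_divisor) auto
    then have "ds ! (Suc i mod length ds) \<in> I"
      using L(2) that(1) by auto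
    then have "ds ! (Suc i mod length ds) \<notin> set cs"
      using comp.hyps(3) by blast
    then show ?thesis
      using L(4)[OF that] id_outside_supp by simp
  qed
  have new: "(cycle_of_list cs \<circ> p) (cs ! i) = cs ! (Suc i mod length cs)" if "i < length cs" for i
  proof -
    have "cs ! i \<notin> I" using that comp.hyps(3) nth_mem by blast
    then show ?thesis using rot[OF that] fix_p by simp
  qed
  show ?case
  proof (cases "cs = []")
    case True
    then show ?thesis using out L old by (intro conjI exI[of _ L]) auto
  next
    case False
    then show ?thesis
      using out L old new comp.hyps(2,3) by (intro conjI exI[of _ "cs # L"]) auto
  qed
qed

section \<open>Assembling arcs into closed curves\<close>

definition closed_system :: "(real \<Rightarrow> complex) set \<Rightarrow> bool" where
  "closed_system A \<longleftrightarrow> finite A \<and> (\<forall>g\<in>A. path g) \<and> inj_on pathstart A \<and> inj_on pathfinish A \<and>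
     pathstart ` A = pathfinish ` A"

text \<open>Mapping each arc to the one that starts at its end permutes the arcs, and the cycles of
  this permutation are closed chains. This supplies the witness for the choice made in
  \<open>closed_curves\<close>.\<close>

lemma closed_chains_exist:
  assumes "closed_system A"
  shows "\<exists>L. distinct (concat L) \<and> set (concat L) = A \<and> (\<forall>gs\<in>set L. closed_chain gs)"
proof -
  have A: "finite A" "inj_on pathstart A" "inj_on pathfinish A" "pathfinish ` A = pathstart ` A"
    using assms by (auto simp: closed_system_def)
  define p where "p = (\<lambda>g. if g \<in> A then inv_into A pathstart (pathfinish g) else g)"
  have start_p: "pathstart (p g) = pathfinish g" if "g \<in> A" for g
  proof -
    have "pathfinish g \<in> pathstart ` A" using that A(4) by blast
    then show ?thesis using that by (simp add: p_def f_inv_into_f)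
  qed
  have "p ` A \<subseteq> A"
    unfolding p_def using A(4) by (auto intro!: inv_into_into)
  moreover have "inj_on p A"
    using A(3) start_p by (metis inj_on_def)
  ultimately have "bij_betw p A A"
    using A(1) by (simp add: bij_betw_def endo_inj_surj)
  then have "p permutes A"
    by (rule bij_imp_permutes) (simp add: p_def)
  then have "cycle_decomp A p"
    using A(1) by (rule cycle_decomposition)
  then obtain L where L: "distinct (concat L)" "set (concat L) = A"
      "\<forall>cs\<in>set L. cs \<noteq> [] \<and> (\<forall>i<length cs. p (cs ! i) = cs ! (Suc i mod length cs))"
    using cycle_decomp_lists by blast
  have "closed_chain gs" if gs: "gs \<in> set L" for gs
    unfolding closed_chain_def
  proof (intro conjI allI impI)
    show "gs \<noteq> []" using L(3) gs by blast
    fix i assume i: "i < length gs"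
    then have "gs ! i \<in> A" using L(2) gs nth_mem by fastforce
    from start_p[OF this] show "pathfinish (gs ! i) = pathstart (gs ! (Suc i mod length gs))"
      using L(3) gs i by simp
  qed
  then show ?thesis using L by blast
qed

text \<open>The ends are not assumed to meet, since the induction passes through partial joins;
  additivity of winding numbers holds for open paths as well.\<close>

lemma join_list_chain:
  assumes "gs \<noteq> []" "\<forall>g\<in>set gs. path g"
    and "\<forall>i. Suc i < length gs \<longrightarrow> pathfinish (gs ! i) = pathstart (gs ! Suc i)"
  shows "path (join_list gs) \<and> pathstart (join_list gs) = pathstart (hd gs) \<and>
    pathfinish (join_list gs) = pathfinish (last gs) \<and>
    path_image (join_list gs) = \<Union>(path_image ` set gs) \<and>
    (\<forall>z. z \<notin> \<Union>(path_image ` set gs) \<longrightarrow>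
      winding_number (join_list gs) z = (\<Sum>g\<leftarrow>gs. winding_number g z))"
  using assms
proof (induction gs rule: join_list.induct)
  case (3 g h gs)
  have "\<forall>i. Suc i < length (h # gs) \<longrightarrow> pathfinish ((h # gs) ! i) = pathstart ((h # gs) ! Suc i)"
    using "3.prems"(3) by (metis Suc_less_eq length_Cons nth_Cons_Suc)
  note IH = "3.IH"[OF _ _ this]
  have "pathfinish g = pathstart h"
    using "3.prems"(3) by fastforce
  then show ?case
    using IH "3.prems" by (auto simp: path_image_join winding_number_join)
qed auto

lemma closed_chain_join:
  assumes "closed_chain gs" "\<forall>g\<in>set gs. path g"
  shows "path (join_list gs)" "pathfinish (join_list gs) = pathstart (join_list gs)"
    "path_image (join_list gs) = \<Union>(path_image ` set gs)"
    "z \<notin> \<Union>(path_image ` set gs) \<Longrightarrow> winding_number (join_list gs) z = (\<Sum>g\<leftarrow>gs. winding_number g z)"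
proof -
  have ne: "gs \<noteq> []" and c: "\<And>i. i < length gs \<Longrightarrow> pathfinish (gs ! i) = pathstart (gs ! (Suc i mod length gs))"
    using assms(1) by (auto simp: closed_chain_def)
  have "\<forall>i. Suc i < length gs \<longrightarrow> pathfinish (gs ! i) = pathstart (gs ! Suc i)"
    using c by (metis Suc_lessD mod_less)
  note j = join_list_chain[OF ne assms(2) this]
  have "pathfinish (last gs) = pathstart (hd gs)"
    using c[of "length gs - 1"] ne by (simp add: last_conv_nth hd_conv_nth)
  then show "pathfinish (join_list gs) = pathstart (join_list gs)"
    using j by simp
  show "path (join_list gs)" "path_image (join_list gs) = \<Union>(path_image ` set gs)"
    "z \<notin> \<Union>(path_image ` set gs) \<Longrightarrow> winding_number (join_list gs) z = (\<Sum>g\<leftarrow>gs. winding_number g z)"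
    using j by blast+
qed

text \<open>Complex-valued because single arcs need not have integral winding numbers; off a closed
  system of arcs the sum is an integer.\<close>

definition total_winding :: "(real \<Rightarrow> complex) set \<Rightarrow> complex \<Rightarrow> complex" where
  "total_winding A z = (\<Sum>g\<in>A. winding_number g z)"

lemma of_int_wind:
  assumes "path \<gamma>" "pathfinish \<gamma> = pathstart \<gamma>" "z \<notin> path_image \<gamma>"
  shows "of_int (wind \<gamma> z) = winding_number \<gamma> z"
proof -
  obtain n where n: "winding_number \<gamma> z = of_int n"
    using integer_winding_number[OF assms] by (auto elim: Ints_cases)
  then have "wind \<gamma> z = n"
    unfolding wind_def by (intro the_equality) auto
  then show ?thesis using n by simp
qed

text \<open>Every arc occurs exactly once in the chosen chains, so regrouping the sum removes the
  dependence on the choice.\<close>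

lemma closed_curves_winding:
  assumes A: "closed_system A"
  shows "\<And>\<gamma>. \<gamma> \<in> set (closed_curves A) \<Longrightarrow>
      path \<gamma> \<and> pathfinish \<gamma> = pathstart \<gamma> \<and> path_image \<gamma> \<subseteq> \<Union>(path_image ` A)"
    and "z \<notin> \<Union>(path_image ` A) \<Longrightarrow> (\<Sum>\<gamma>\<leftarrow>closed_curves A. winding_number \<gamma> z) = total_winding A z"
proof -
  define L where "L = (SOME L. distinct (concat L) \<and> set (concat L) = A \<and> (\<forall>gs\<in>set L. closed_chain gs))"
  have L: "distinct (concat L)" "set (concat L) = A" "\<forall>gs\<in>set L. closed_chain gs"
    using someI_ex[OF closed_chains_exist[OF A]] unfolding L_def by blast+
  have cc: "closed_curves A = map join_list L"
    by (simp add: closed_curves_def L_def)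
  have sub: "set gs \<subseteq> A" "\<forall>g\<in>set gs. path g" "closed_chain gs" if "gs \<in> set L" for gs
    using that L A by (auto simp: closed_system_def)
  show "path \<gamma> \<and> pathfinish \<gamma> = pathstart \<gamma> \<and> path_image \<gamma> \<subseteq> \<Union>(path_image ` A)"
    if g: "\<gamma> \<in> set (closed_curves A)" for \<gamma>
  proof -
    obtain gs where gs: "gs \<in> set L" "\<gamma> = join_list gs"
      using g by (auto simp: cc)
    show ?thesis
      unfolding gs(2) using closed_chain_join[OF sub(3,2)[OF gs(1)]] sub(1)[OF gs(1)] by auto
  qed
  assume z: "z \<notin> \<Union>(path_image ` A)"
  have "(\<Sum>\<gamma>\<leftarrow>closed_curves A. winding_number \<gamma> z) = (\<Sum>gs\<leftarrow>L. \<Sum>g\<leftarrow>gs. winding_number g z)"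
    unfolding cc list.map_comp o_def
  proof (intro arg_cong[where f = sum_list] map_cong refl)
    fix gs assume gs: "gs \<in> set L"
    then have "z \<notin> \<Union>(path_image ` set gs)" using z sub(1)[OF gs] by blast
    then show "winding_number (join_list gs) z = (\<Sum>g\<leftarrow>gs. winding_number g z)"
      using closed_chain_join(4)[OF sub(3,2)[OF gs]] by simp
  qed
  also have "\<dots> = (\<Sum>g\<leftarrow>concat L. winding_number g z)"
    by (induction L) auto
  also have "\<dots> = total_winding A z"
    using L by (simp add: total_winding_def sum_list_distinct_conv_sum_set)
  finally show "(\<Sum>\<gamma>\<leftarrow>closed_curves A. winding_number \<gamma> z) = total_winding A z" .
qed

lemma sum_wind_closed_curves:
  assumes A: "closed_system A" and z: "z \<notin> \<Union>(path_image ` A)"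
  shows "of_int (\<Sum>\<gamma>\<leftarrow>closed_curves A. wind \<gamma> z) = total_winding A z"
proof -
  have "of_int (\<Sum>\<gamma>\<leftarrow>closed_curves A. wind \<gamma> z) = (\<Sum>\<gamma>\<leftarrow>closed_curves A. of_int (wind \<gamma> z) :: complex)"
  proof -
    have "of_int (\<Sum>\<gamma>\<leftarrow>gs. wind \<gamma> z) = (\<Sum>\<gamma>\<leftarrow>gs. of_int (wind \<gamma> z) :: complex)" for gs
      by (induction gs) simp_all
    then show ?thesis .
  qed
  also have "\<dots> = (\<Sum>\<gamma>\<leftarrow>closed_curves A. winding_number \<gamma> z)"
    using closed_curves_winding(1)[OF A] z
    by (intro arg_cong[where f = sum_list] map_cong refl of_int_wind) auto
  finally show ?thesis
    using closed_curves_winding(2)[OF A z] by simp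
qed

text \<open>Constancy fails for single arcs; it is inherited from the closed curves into which the
  arcs are joined.\<close>

lemma total_winding_constant:
  assumes A: "closed_system A" and S: "connected S" "S \<inter> \<Union>(path_image ` A) = {}" "z \<in> S" "z' \<in> S"
  shows "total_winding A z = total_winding A z'"
proof -
  have "winding_number \<gamma> z = winding_number \<gamma> z'" if "\<gamma> \<in> set (closed_curves A)" for \<gamma>
  proof -
    have "path \<gamma>" "pathfinish \<gamma> = pathstart \<gamma>" "S \<inter> path_image \<gamma> = {}"
      using closed_curves_winding(1)[OF A that] S(2) by auto
    from winding_number_constant[OF this(1,2) S(1) this(3)] show ?thesis
      using S(3,4) by (auto simp: constant_on_def)
  qed
  then have "(\<Sum>\<gamma>\<leftarrow>closed_curves A. winding_number \<gamma> z) = (\<Sum>\<gamma>\<leftarrow>closed_curves A. winding_number \<gamma> z')"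
    by (intro arg_cong[where f = sum_list] map_cong refl)
  moreover have "z \<notin> \<Union>(path_image ` A)" "z' \<notin> \<Union>(path_image ` A)"
    using S by blast+
  ultimately show ?thesis
    using closed_curves_winding(2)[OF A] by metis
qed

section \<open>The drawing of a tiling\<close>

lemma square_center_eq_iff: "square_center q = square_center q' \<longleftrightarrow> q = q'"
  by (cases q; cases q') (auto simp: square_center_def complex_eq_iff)

lemma share_face_sym: "share_face a b \<longleftrightarrow> share_face b a"
  by (auto simp: share_face_def)

lemma share_face_white:
  assumes "share_face a b"
  shows "white a \<longleftrightarrow> \<not> white b"
proof -
  obtain x y z x' y' z' where ab: "a = (x, y, z)" "b = (x', y', z')"
    by (metis prod_cases3)
  then have "\<bar>x - x'\<bar> + \<bar>y - y'\<bar> + \<bar>z - z'\<bar> = 1"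
    using assms by (simp add: share_face_def)
  then have "even (x + y + z) \<longleftrightarrow> odd (x' + y' + z')"
    by presburger
  then show ?thesis using ab by (simp add: white_def)
qed

lemma domino_partner:
  assumes "domino d" "c \<in> d"
  shows "\<exists>b. d = {c, b} \<and> share_face c b"
proof -
  obtain a b where "share_face a b" "d = {a, b}" using assms(1) by (auto simp: domino_def)
  then show ?thesis using assms(2) share_face_sym[of a b] by blast
qed

lemma domino_share_face: "domino {a, b} \<Longrightarrow> share_face a b"
  using domino_partner[of "{a, b}" a] by (auto simp: doubleton_eq_iff)

definition two_layer :: "cell set \<Rightarrow> bool" where
  "two_layer R \<longleftrightarrow> finite R \<and> (\<forall>x y z. (x, y, z) \<in> R \<longrightarrow> z \<in> {0, 1})"

lemma two_layerD: "two_layer R \<Longrightarrow> (x, y, z) \<in> R \<Longrightarrow> z = 0 \<or> z = 1"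
  by (auto simp: two_layer_def)

lemma same_colour_eq:
  assumes "two_layer R" "c \<in> R" "d \<in> R" "proj c = proj d" "white c = white d"
  shows "c = d"
proof -
  obtain x y z x' y' z' where cd: "c = (x, y, z)" "d = (x', y', z')"
    by (metis prod_cases3)
  then show ?thesis
    using assms(4,5) two_layerD[OF assms(1), of x y z] two_layerD[OF assms(1), of x' y' z'] assms(2,3)
    by (auto simp: proj_def white_def)
qed

lemma proj_eq_jewel:
  assumes R: "two_layer R" and t: "tiling R t" and d: "{c, b} \<in> t" and p: "proj b = proj c"
  shows "proj c \<in> jewels t" "proj c \<in> full_squares R"
proof -
  obtain x y z x' y' z' where c: "c = (x, y, z)" and b: "b = (x', y', z')"
    by (metis prod_cases3)
  have "share_face c b" using domino_share_face tiling_domino[OF t d] by blast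
  moreover have "c \<in> R" "b \<in> R" using tiling_subset[OF t d] by auto
  ultimately have "{c, b} = {(x, y, 0), (x, y, 1)}"
    using two_layerD[OF R, of x y z] two_layerD[OF R, of x' y' z'] p
    by (auto simp: c b share_face_def proj_def)
  then show "proj c \<in> jewels t" "proj c \<in> full_squares R"
    using d \<open>c \<in> R\<close> \<open>b \<in> R\<close> by (auto simp: jewels_def full_squares_def c proj_def doubleton_eq_iff insert_commute)
qed

lemma jewel_domino:
  assumes R: "two_layer R" and t: "tiling R t" and d: "{c, b} \<in> t" and j: "proj c \<in> jewels t"
  shows "proj b = proj c"
proof -
  obtain x y z where c: "c = (x, y, z)" by (metis prod_cases3)
  have "c \<in> R" using tiling_subset[OF t d] by auto
  then have "c \<in> {(x, y, 0), (x, y, 1)}" using R by (auto simp: c two_layer_def)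
  moreover have "{(x, y, 0), (x, y, 1)} \<in> t" using j by (auto simp: c jewels_def proj_def)
  ultimately have "{c, b} = {(x, y, 0), (x, y, 1)}"
    using tiling_unique[OF t d] by blast
  then show ?thesis by (auto simp: c proj_def doubleton_eq_iff)
qed

text \<open>Used with \<open>col\<close> one of the two colours.\<close>

lemma horizontal_ends:
  assumes R: "two_layer R" and t: "tiling R t" and col: "\<And>x y. col (x, y, 0) \<or> col (x, y, 1)"
  shows "{proj c | c b. {c, b} \<in> t \<and> col c \<and> proj c \<noteq> proj b} =
    (full_squares R - jewels t) \<union> {proj c | c. c \<in> R \<and> col c \<and> proj c \<notin> full_squares R}"
proof (intro equalityI subsetI)
  fix q assume "q \<in> {proj c | c b. {c, b} \<in> t \<and> col c \<and> proj c \<noteq> proj b}"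
  then obtain c b where cb: "{c, b} \<in> t" "col c" "proj c \<noteq> proj b" "q = proj c" by blast
  have "c \<in> R" using tiling_subset[OF t cb(1)] by auto
  moreover have "q \<notin> jewels t" using jewel_domino[OF R t cb(1)] cb by auto
  ultimately show "q \<in> (full_squares R - jewels t) \<union> {proj c | c. c \<in> R \<and> col c \<and> proj c \<notin> full_squares R}"
    using cb by blast
next
  have *: "proj c \<in> {proj c | c b. {c, b} \<in> t \<and> col c \<and> proj c \<noteq> proj b}"
    if "c \<in> R" "col c" "proj c \<notin> full_squares R \<or> proj c \<notin> jewels t" for c
  proof -
    obtain d where "d \<in> t" "c \<in> d" using tiling_cover[OF t] \<open>c \<in> R\<close> by blast
    then obtain b where cb: "{c, b} \<in> t" using domino_partner[OF tiling_domino[OF t]] by metis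
    have "proj c \<noteq> proj b" using proj_eq_jewel[OF R t cb] that(3) by auto
    then show ?thesis using cb that(2) by blast
  qed
  fix q assume "q \<in> (full_squares R - jewels t) \<union> {proj c | c. c \<in> R \<and> col c \<and> proj c \<notin> full_squares R}"
  then consider "q \<in> full_squares R" "q \<notin> jewels t" | c where "c \<in> R" "col c" "proj c \<notin> full_squares R" "q = proj c"
    by blast
  then show "q \<in> {proj c | c b. {c, b} \<in> t \<and> col c \<and> proj c \<noteq> proj b}"
  proof cases
    case 1
    obtain x y where q: "q = (x, y)" by (cases q)
    obtain z where "(x, y, z) \<in> R" "col (x, y, z)"
      using col[of x y] 1(1) by (auto simp: q full_squares_def)
    then show ?thesis using *[of "(x, y, z)"] 1(2) by (simp add: q proj_def)
  next
    case 2
    then show ?thesis using *[of c] by blast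
  qed
qed

lemma white_or: "white (x, y, 0) \<or> white (x, y, 1)" "black (x, y, 0) \<or> black (x, y, 1)"
  by (auto simp: white_def)

lemma Collect_pair_image: "{f a b | a b. P a b} = (\<lambda>(a, b). f a b) ` {(a, b). P a b}"
  by auto

text \<open>Over a full square without a jewel both cubes lie in horizontal dominoes: the white one
  gives a departing segment, the black one an arriving segment. A sink has only the white cube and a
  source only the black one.\<close>

lemma segments_ends:
  assumes R: "two_layer R" and t: "tiling R t"
  shows "pathstart ` segments t = square_center ` ((full_squares R - jewels t) \<union> sinks R)"
    "pathfinish ` segments t = square_center ` ((full_squares R - jewels t) \<union> sources R)"
proof -
  have other: "black b \<longleftrightarrow> white w" if "{w, b} \<in> t" for w b
    using share_face_white[OF domino_share_face[OF tiling_domino[OF t that]]] by blast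
  let ?P = "{(w, b). {w, b} \<in> t \<and> white w \<and> black b \<and> proj w \<noteq> proj b}"
  have seg: "segments t = (\<lambda>(w, b). linepath (square_center (proj w)) (square_center (proj b))) ` ?P"
    unfolding segments_def by (rule Collect_pair_image)
  have "pathstart ` segments t = square_center ` (\<lambda>(w, b). proj w) ` ?P"
    by (simp add: seg image_image case_prod_beta)
  also have "(\<lambda>(w, b). proj w) ` ?P = {proj c | c b. {c, b} \<in> t \<and> white c \<and> proj c \<noteq> proj b}"
    unfolding Collect_pair_image[symmetric] using other by blast
  finally have "pathstart ` segments t = square_center ` {proj c | c b. {c, b} \<in> t \<and> white c \<and> proj c \<noteq> proj b}" .
  then show "pathstart ` segments t = square_center ` ((full_squares R - jewels t) \<union> sinks R)"
    unfolding horizontal_ends[OF R t white_or(1)] sinks_def .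
  have "pathfinish ` segments t = square_center ` (\<lambda>(w, b). proj b) ` ?P"
    by (simp add: seg image_image case_prod_beta)
  also have "(\<lambda>(w, b). proj b) ` ?P = {proj c | c b. {c, b} \<in> t \<and> black c \<and> proj c \<noteq> proj b}"
    (is "?L = ?M")
  proof (intro equalityI subsetI)
    fix q assume "q \<in> ?M"
    then obtain c b where cb: "{c, b} \<in> t" "black c" "proj c \<noteq> proj b" "q = proj c" by blast
    then have "{b, c} \<in> t" "white b" using other[of c b] by (auto simp: insert_commute)
    then have "(b, c) \<in> ?P" using cb by auto
    then show "q \<in> ?L" using cb(4) by force
  next
    fix q assume "q \<in> ?L"
    then obtain w b where wb: "{w, b} \<in> t" "black b" "proj w \<noteq> proj b" "q = proj b"
      unfolding Collect_pair_image[symmetric] by blast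
    have "{b, w} \<in> t" using wb(1) by (simp add: insert_commute)
    then show "q \<in> ?M" using wb(2-4) by (intro CollectI exI[of _ b] exI[of _ w]) simp
  qed
  finally have "pathfinish ` segments t = square_center ` {proj c | c b. {c, b} \<in> t \<and> black c \<and> proj c \<noteq> proj b}" .
  then show "pathfinish ` segments t = square_center ` ((full_squares R - jewels t) \<union> sources R)"
    unfolding horizontal_ends[OF R t white_or(2)] sources_def .
qed

lemma source_not_sink:
  assumes R: "two_layer R"
  shows "sources R \<inter> sinks R = {}" "sources R \<inter> full_squares R = {}" "sinks R \<inter> full_squares R = {}"
proof -
  have "c = d" if "c \<in> R" "d \<in> R" "proj c = proj d" "proj c \<notin> full_squares R" for c d
  proof -
    obtain x y z x' y' z' where cd: "c = (x, y, z)" "d = (x', y', z')"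
      by (metis prod_cases3)
    then show ?thesis
      using that two_layerD[OF R, of x y z] two_layerD[OF R, of x' y' z']
      by (auto simp: proj_def full_squares_def)
  qed
  then show "sources R \<inter> sinks R = {}"
    unfolding sources_def sinks_def by blast
  show "sources R \<inter> full_squares R = {}" "sinks R \<inter> full_squares R = {}"
    by (auto simp: sources_def sinks_def)
qed

lemma segments_inj:
  assumes R: "two_layer R" and t: "tiling R t"
  shows "inj_on pathstart (segments t)" "inj_on pathfinish (segments t)"
proof -
  have w: "b = b' \<and> w = w'" if "{w, b} \<in> t" "{w', b'} \<in> t" "white w = white w'" "proj w = proj w'" for w b w' b'
  proof -
    have "w = w'"
      using same_colour_eq[OF R _ _ that(4,3)] tiling_subset[OF t that(1)] tiling_subset[OF t that(2)] by auto
    then show ?thesis using tiling_partner_unique[OF t] that by blast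
  qed
  show "inj_on pathstart (segments t)"
  proof (rule inj_onI)
    fix g g' assume "g \<in> segments t" "g' \<in> segments t" and eq: "pathstart g = pathstart g'"
    then obtain v b v' b' where "g = linepath (square_center (proj v)) (square_center (proj b))"
      "g' = linepath (square_center (proj v')) (square_center (proj b'))"
      "{v, b} \<in> t" "{v', b'} \<in> t" "white v" "white v'"
      unfolding segments_def by blast
    then show "g = g'" using w[of v b v' b'] eq by (simp add: square_center_eq_iff)
  qed
  show "inj_on pathfinish (segments t)"
  proof (rule inj_onI)
    fix g g' assume "g \<in> segments t" "g' \<in> segments t" and eq: "pathfinish g = pathfinish g'"
    then obtain v b v' b' where "g = linepath (square_center (proj v)) (square_center (proj b))"
      "g' = linepath (square_center (proj v')) (square_center (proj b'))"
      "{v, b} \<in> t" "{v', b'} \<in> t" "black b" "black b'"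
      unfolding segments_def by blast
    then show "g = g'" using w[of b v b' v'] eq by (simp add: square_center_eq_iff insert_commute)
  qed
qed

lemma finite_segments:
  assumes R: "two_layer R" and t: "tiling R t"
  shows "finite (segments t)"
proof -
  have "segments t \<subseteq> (\<lambda>(w, b). linepath (square_center (proj w)) (square_center (proj b))) ` (R \<times> R)"
  proof
    fix g assume "g \<in> segments t"
    then obtain w b where g: "g = linepath (square_center (proj w)) (square_center (proj b))" "{w, b} \<in> t"
      unfolding segments_def by blast
    then have "(w, b) \<in> R \<times> R" using tiling_subset[OF t] by blast
    then show "g \<in> (\<lambda>(w, b). linepath (square_center (proj w)) (square_center (proj b))) ` (R \<times> R)"
      using g(1) by force
  qed
  then show ?thesis
    by (rule finite_subset) (use R in \<open>simp add: two_layer_def\<close>)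
qed

text \<open>Ghost curves start at sources, where no segment starts.\<close>

lemma ghost_segments_disjoint:
  assumes R: "two_layer R" and t: "tiling R t" and G: "ghost_curves R G"
  shows "segments t \<inter> G = {}"
proof -
  have "pathstart ` segments t \<inter> pathstart ` G = {}"
    using G source_not_sink[OF R] unfolding segments_ends(1)[OF R t] ghost_curves_def
    by (fastforce simp: square_center_eq_iff)
  then show ?thesis by blast
qed

lemma ghost_curves_ends:
  assumes R: "two_layer R" and G: "ghost_curves R G"
  shows "pathstart ` G = square_center ` sources R" "pathfinish ` G = square_center ` sinks R"
    "inj_on pathstart G" "inj_on pathfinish G" "finite G"
proof -
  show start: "pathstart ` G = square_center ` sources R" "pathfinish ` G = square_center ` sinks R"
    using G unfolding ghost_curves_def by (fastforce simp: image_iff)+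
  show inj: "inj_on pathstart G" "inj_on pathfinish G"
    using G unfolding ghost_curves_def inj_on_def by (metis imageE)+
  have "sources R \<subseteq> proj ` R" by (auto simp: sources_def)
  then have "finite (sources R)"
    using R finite_subset by (auto simp: two_layer_def)
  then show "finite G"
    using start inj finite_imageD[of pathstart G] by simp
qed

text \<open>Segments only end at sources and only start at sinks; the ghost curves supply exactly
  the missing departures and arrivals.\<close>

lemma closed_system_drawing:
  assumes R: "two_layer R" and t: "tiling R t" and G: "ghost_curves R G"
  shows "closed_system (segments t \<union> G)"
proof -
  note g = ghost_curves_ends[OF R G] and s = segments_ends[OF R t] and n = source_not_sink[OF R]
  have "pathstart ` segments t \<inter> pathstart ` G = {}" "pathfinish ` segments t \<inter> pathfinish ` G = {}"
    unfolding g s using n by (auto simp: square_center_eq_iff)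
  then have "inj_on pathstart (segments t \<union> G)" "inj_on pathfinish (segments t \<union> G)"
    using g(3,4) segments_inj[OF R t] by (auto simp: inj_on_Un)
  moreover have "pathstart ` (segments t \<union> G) = pathfinish ` (segments t \<union> G)"
    unfolding image_Un g s by blast
  moreover have "\<forall>g\<in>segments t \<union> G. path g"
    using G by (auto simp: segments_def ghost_curves_def)
  ultimately show ?thesis
    using g(5) finite_segments[OF R t] by (simp add: closed_system_def)
qed

section \<open>The two tilings of a trit\<close>

text \<open>The horizontal dominoes meet over the square \<open>(x, y)\<close>, the jewel is at the opposite square
  \<open>(x + \<alpha>, y + \<beta>)\<close> of the block. The other tiling has the same shape, with the roles of the two
  squares exchanged.\<close>

definition trit_tiling :: "int \<Rightarrow> int \<Rightarrow> int \<Rightarrow> int \<Rightarrow> int \<Rightarrow> cell set set" where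
  "trit_tiling x y z \<alpha> \<beta> = {{(x, y, z), (x + \<alpha>, y, z)}, {(x, y, 1 - z), (x, y + \<beta>, 1 - z)},
     {(x + \<alpha>, y + \<beta>, z), (x + \<alpha>, y + \<beta>, 1 - z)}}"

definition other_tiling :: "int \<Rightarrow> int \<Rightarrow> int \<Rightarrow> int \<Rightarrow> int \<Rightarrow> cell set set" where
  "other_tiling x y z \<alpha> \<beta> = trit_tiling (x + \<alpha>) (y + \<beta>) (1 - z) (- \<alpha>) (- \<beta>)"

lemma other_tiling_eq: "other_tiling x y z \<alpha> \<beta> = {{(x + \<alpha>, y + \<beta>, 1 - z), (x, y + \<beta>, 1 - z)},
    {(x + \<alpha>, y + \<beta>, z), (x + \<alpha>, y, z)}, {(x, y, 1 - z), (x, y, z)}}"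
  by (simp add: other_tiling_def trit_tiling_def)

definition trit_cells :: "int \<Rightarrow> int \<Rightarrow> int \<Rightarrow> int \<Rightarrow> int \<Rightarrow> cell set" where
  "trit_cells x y z \<alpha> \<beta> = {(x, y, z), (x, y, 1 - z), (x + \<alpha>, y, z), (x, y + \<beta>, 1 - z),
     (x + \<alpha>, y + \<beta>, z), (x + \<alpha>, y + \<beta>, 1 - z)}"

lemma Union_trit_tiling:
  "\<Union>(trit_tiling x y z \<alpha> \<beta>) = trit_cells x y z \<alpha> \<beta>"
  "\<Union>(other_tiling x y z \<alpha> \<beta>) = trit_cells x y z \<alpha> \<beta>"
  unfolding other_tiling_eq unfolding trit_tiling_def trit_cells_def by blast+

lemma tiling_subset_eq:
  assumes t: "tiling R t" and u: "u \<subseteq> t" "\<Union>u = R"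
  shows "u = t"
proof (intro equalityI u(1) subsetI)
  fix d assume d: "d \<in> t"
  obtain c where c: "c \<in> d" using domino_nonempty[OF tiling_domino[OF t d]] by blast
  then obtain e where "e \<in> u" "c \<in> e" using tiling_subset[OF t d] u(2) by blast
  then show "d \<in> u" using tiling_unique[OF t d _ c] u(1) by blast
qed

text \<open>Under sharing of faces the six cells form a ring; for five of them these are the two
  neighbours in the ring.\<close>

lemma trit_partners:
  assumes \<alpha>: "\<alpha> \<in> {1, -1}" "\<beta> \<in> {1, -1}" and z: "z \<in> {0, 1}"
    and b: "b \<in> trit_cells x y z \<alpha> \<beta>"
  shows "share_face (x + \<alpha>, y, z) b \<Longrightarrow> b = (x, y, z) \<or> b = (x + \<alpha>, y + \<beta>, z)"
    "share_face (x, y + \<beta>, 1 - z) b \<Longrightarrow> b = (x, y, 1 - z) \<or> b = (x + \<alpha>, y + \<beta>, 1 - z)"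
    "share_face (x, y, z) b \<Longrightarrow> b = (x, y, 1 - z) \<or> b = (x + \<alpha>, y, z)"
    "share_face (x, y, 1 - z) b \<Longrightarrow> b = (x, y, z) \<or> b = (x, y + \<beta>, 1 - z)"
    "share_face (x + \<alpha>, y + \<beta>, z) b \<Longrightarrow> b = (x + \<alpha>, y + \<beta>, 1 - z) \<or> b = (x + \<alpha>, y, z)"
  using \<alpha> z b[unfolded trit_cells_def]
  by (elim insertE emptyE; simp add: share_face_def; fail)+

text \<open>A ring of six cells has exactly two perfect matchings: the partner of one cell forces
  all the others.\<close>

lemma trit_tiling_unique:
  assumes \<alpha>: "\<alpha> \<in> {1, -1}" "\<beta> \<in> {1, -1}" and z: "z \<in> {0, 1}"
    and u: "tiling (trit_cells x y z \<alpha> \<beta>) u"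
  shows "u = trit_tiling x y z \<alpha> \<beta> \<or> u = other_tiling x y z \<alpha> \<beta>"
proof -
  let ?U = "trit_cells x y z \<alpha> \<beta>"
  have partner: "\<exists>b\<in>?U. {c, b} \<in> u \<and> share_face c b" if "c \<in> ?U" for c
  proof -
    obtain d where d: "d \<in> u" "c \<in> d" using tiling_cover[OF u] \<open>c \<in> ?U\<close> by blast
    then obtain b where "d = {c, b}" "share_face c b" using domino_partner[OF tiling_domino[OF u]] by metis
    then show ?thesis using d tiling_subset[OF u] by blast
  qed
  have mem: "(x, y, z) \<in> ?U" "(x, y, 1 - z) \<in> ?U" "(x + \<alpha>, y, z) \<in> ?U" "(x, y + \<beta>, 1 - z) \<in> ?U"
     "(x + \<alpha>, y + \<beta>, z) \<in> ?U"
    by (auto simp: trit_cells_def)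
  note p = trit_partners[OF \<alpha> z]
  have uniq: "b = b'" if "{c, b} \<in> u" "{c, b'} \<in> u" for c b b'
    using tiling_partner_unique[OF u that] .
  have ne: "\<alpha> \<noteq> 0" "\<beta> \<noteq> 0" "z \<noteq> 1 - z" using \<alpha> z by auto
  consider (1) "{(x + \<alpha>, y, z), (x, y, z)} \<in> u" | (2) "{(x + \<alpha>, y, z), (x + \<alpha>, y + \<beta>, z)} \<in> u"
    using partner[OF mem(3)] p(1) by metis
  then show ?thesis
  proof cases
    case 1
    have "{(x, y, 1 - z), (x, y, z)} \<notin> u"
      using uniq[of "(x, y, z)" "(x + \<alpha>, y, z)" "(x, y, 1 - z)"] 1 ne by (auto simp: insert_commute)
    then have 2: "{(x, y, 1 - z), (x, y + \<beta>, 1 - z)} \<in> u"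
      using partner[OF mem(2)] p(4) by metis
    have "{(x + \<alpha>, y + \<beta>, z), (x + \<alpha>, y, z)} \<notin> u"
      using uniq[of "(x + \<alpha>, y, z)" "(x, y, z)" "(x + \<alpha>, y + \<beta>, z)"] 1 ne by (auto simp: insert_commute)
    then have "{(x + \<alpha>, y + \<beta>, z), (x + \<alpha>, y + \<beta>, 1 - z)} \<in> u"
      using partner[OF mem(5)] p(5) by metis
    then have "trit_tiling x y z \<alpha> \<beta> \<subseteq> u"
      using 1 2 by (simp add: trit_tiling_def insert_commute)
    then show ?thesis
      using tiling_subset_eq[OF u _ Union_trit_tiling(1)] by simp
  next
    case 2
    have "{(x, y, z), (x + \<alpha>, y, z)} \<notin> u"
      using uniq[of "(x + \<alpha>, y, z)" "(x, y, z)" "(x + \<alpha>, y + \<beta>, z)"] 2 ne by (auto simp: insert_commute)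
    then have 3: "{(x, y, z), (x, y, 1 - z)} \<in> u"
      using partner[OF mem(1)] p(3) by metis
    have "{(x, y + \<beta>, 1 - z), (x, y, 1 - z)} \<notin> u"
      using uniq[of "(x, y, 1 - z)" "(x, y, z)" "(x, y + \<beta>, 1 - z)"] 3 ne by (auto simp: insert_commute)
    then have "{(x, y + \<beta>, 1 - z), (x + \<alpha>, y + \<beta>, 1 - z)} \<in> u"
      using partner[OF mem(4)] p(2) by metis
    then have "other_tiling x y z \<alpha> \<beta> \<subseteq> u"
      using 2 3 by (simp add: other_tiling_eq insert_commute)
    then show ?thesis
      using tiling_subset_eq[OF u _ Union_trit_tiling(2)] by simp
  qed
qed

text \<open>Three pairwise non-parallel dominoes represent the three axis directions once each.
  Disjointness then determines everything but the position, the floor and two signs.\<close>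

lemma trit_in_shape:
  assumes R: "two_layer R" and tr: "trit_in R B S S' t t'"
  shows "\<exists>x y z \<alpha> \<beta>. \<alpha> \<in> {1, -1} \<and> \<beta> \<in> {1, -1} \<and> z \<in> {0, 1} \<and> S = trit_tiling x y z \<alpha> \<beta> \<and>
    S' = other_tiling x y z \<alpha> \<beta> \<and> B - \<Union>S = {(x + \<alpha>, y, 1 - z), (x, y + \<beta>, z)}"
proof -
  from tr have t: "tiling R t" and S: "S = {d\<in>t. d \<subseteq> B \<inter> R}" "card S = 3"
      "pairwise (\<lambda>d e. \<not> parallel d e) S" and S': "tiling (\<Union>S) S'" "S' \<noteq> S"
    unfolding trit_in_def by blast+
  obtain l m n where B: "B = {l, l + 1} \<times> {m, m + 1} \<times> {n, n + 1}"
  proof -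
    obtain p where "B = cell_box p (2, 2, 2)" using tr unfolding trit_in_def by blast
    then show thesis using that by (cases p) (simp only: cell_box_cells)
  qed
  have par: "parallel (xdom a b c) (xdom a' b' c')" "parallel (ydom a b c) (ydom a' b' c')"
    "parallel (zdom a b) (zdom a' b')" for a b c a' b' c'
    unfolding parallel_def xdom_def ydom_def zdom_def
    by (rule exI[of _ "(a, b, c)"], rule exI[of _ "(a', b', c')"], rule exI[of _ "(1, 0, 0)"], simp)
       (rule exI[of _ "(a, b, c)"], rule exI[of _ "(a', b', c')"], rule exI[of _ "(0, 1, 0)"], simp,
        rule exI[of _ "(a, b, 0)"], rule exI[of _ "(a', b', 0)"], rule exI[of _ "(0, 0, 1)"], simp)
  define X Y Z where "X = {xdom x y z | x y z. True}" and "Y = {ydom x y z | x y z. True}"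
    and "Z = {zdom x y | x y. True}"
  have XYZ: "d \<in> X \<union> Y \<union> Z" if "d \<in> S" for d
  proof -
    have "d \<in> t" using that S(1) by simp
    then have d: "domino d" "\<forall>(x, y, z)\<in>d. z \<in> {0, 1}"
      using tiling_domino[OF t, of d] tiling_subset[OF t, of d] two_layerD[OF R] by blast+
    show ?thesis
      by (rule domino_cases[OF d]) (auto simp: X_def Y_def Z_def)
  qed
  have fin: "finite S" by (rule card_ge_0_finite) (simp add: S(2))
  have one: "card (S \<inter> K) \<le> 1" if "K \<in> {X, Y, Z}" for K
  proof -
    have "d = e" if "d \<in> S \<inter> K" "e \<in> S \<inter> K" for d e
    proof (rule ccontr)
      assume "d \<noteq> e"
      then have "\<not> parallel d e" using S(3) that by (auto simp: pairwise_def)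
      then show False using that \<open>K \<in> {X, Y, Z}\<close> par by (auto simp: X_def Y_def Z_def)
    qed
    then show ?thesis
      using card_le_Suc0_iff_eq[of "S \<inter> K"] fin by simp
  qed
  have disj: "X \<inter> Y = {}" "X \<inter> Z = {}" "Y \<inter> Z = {}"
    by (auto simp: X_def Y_def Z_def)
  have "S = (S \<inter> X) \<union> ((S \<inter> Y) \<union> (S \<inter> Z))" using XYZ by blast
  moreover have "card ((S \<inter> X) \<union> ((S \<inter> Y) \<union> (S \<inter> Z))) = card (S \<inter> X) + card ((S \<inter> Y) \<union> (S \<inter> Z))"
    by (rule card_Un_disjoint) (use fin disj in blast)+
  moreover have "card ((S \<inter> Y) \<union> (S \<inter> Z)) = card (S \<inter> Y) + card (S \<inter> Z)"
    by (rule card_Un_disjoint) (use fin disj in blast)+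
  ultimately have 1: "card (S \<inter> X) = 1" "card (S \<inter> Y) = 1" "card (S \<inter> Z) = 1"
    using S(2) one[of X] one[of Y] one[of Z] by simp_all
  obtain dx dy dz where dx: "S \<inter> X = {dx}" and dy: "S \<inter> Y = {dy}" and dz: "S \<inter> Z = {dz}"
    using 1 by (meson card_1_singletonE)
  have "dx \<in> X" "dy \<in> Y" "dz \<in> Z" using dx dy dz by blast+
  then obtain a b c a' b' c' e f where "dx = xdom a b c" "dy = ydom a' b' c'" "dz = zdom e f"
    unfolding X_def Y_def Z_def by blast
  with dx dy dz have
    Sx: "S \<inter> X = {xdom a b c}" and Sy: "S \<inter> Y = {ydom a' b' c'}" and Sz: "S \<inter> Z = {zdom e f}"
    by simp_all
  have S_eq: "S = {xdom a b c, ydom a' b' c', zdom e f}"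
    using XYZ Sx Sy Sz by blast
  have sub: "xdom a b c \<subseteq> B \<inter> R" "ydom a' b' c' \<subseteq> B \<inter> R" "zdom e f \<subseteq> B \<inter> R"
    and in_t: "xdom a b c \<in> t" "ydom a' b' c' \<in> t" "zdom e f \<in> t"
    using S(1) S_eq by blast+
  have c: "c = 0 \<or> c = 1" "c' = 0 \<or> c' = 1"
    using sub two_layerD[OF R] by (auto simp: xdom_def ydom_def)
  \<comment> \<open>The vertical domino reaches through both floors, so the box is exactly as high
    as the region.\<close>
  have n: "n = 0" using sub(3) by (auto simp: B zdom_def)
  have co: "a = l" "b = m \<or> b = m + 1" "a' = l \<or> a' = l + 1" "b' = m" "e = l \<or> e = l + 1" "f = m \<or> f = m + 1"
  proof -
    have mem_B: "(i, j, k) \<in> B \<longleftrightarrow> (i = l \<or> i = l + 1) \<and> (j = m \<or> j = m + 1) \<and> (k = n \<or> k = n + 1)"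
      for i j k unfolding B mem_Sigma_iff by (simp only: insert_iff empty_iff simp_thms)
    have "(a, b, c) \<in> B" "(a + 1, b, c) \<in> B" "(a', b', c') \<in> B" "(a', b' + 1, c') \<in> B" "(e, f, 0) \<in> B"
      using sub by (simp_all add: xdom_def ydom_def zdom_def)
    note q = this[unfolded mem_B]
    show "a = l" using q(1,2) by linarith
    show "b' = m" using q(3,4) by linarith
    show "b = m \<or> b = m + 1" "a' = l \<or> a' = l + 1" "e = l \<or> e = l + 1" "f = m \<or> f = m + 1"
      using q by iprover+
  qed
  have d: "xdom a b c \<inter> zdom e f = {}" "ydom a' b' c' \<inter> zdom e f = {}" "xdom a b c \<inter> ydom a' b' c' = {}"
    using tiling_disjnt[OF t in_t(1,3)] tiling_disjnt[OF t in_t(2,3)] tiling_disjnt[OF t in_t(1,2)]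
    by (simp_all add: disjnt_def)
  \<comment> \<open>The domino along the first axis spans the box, so in the row of the jewel it
    would hit the column; likewise for the second axis. The two horizontal dominoes share a square
    in projection, which forces them onto different floors.\<close>
  have "b \<noteq> f" using d(1) co c unfolding xdom_def zdom_def by fastforce
  have "a' \<noteq> e" using d(2) co c unfolding ydom_def zdom_def by fastforce
  have "c' = 1 - c" using d(3) co c unfolding xdom_def ydom_def by fastforce
  define \<alpha> \<beta> where "\<alpha> = e - a'" and "\<beta> = f - b"
  have \<alpha>: "\<alpha> \<in> {1, -1}" "\<beta> \<in> {1, -1}"
    using co \<open>b \<noteq> f\<close> \<open>a' \<noteq> e\<close> by (auto simp: \<alpha>_def \<beta>_def)
  have z: "c \<in> {0, 1}" using c by auto
  have "xdom a b c = {(a', b, c), (a' + \<alpha>, b, c)}"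
    using co \<open>a' \<noteq> e\<close> by (auto simp: xdom_def \<alpha>_def)
  moreover have "ydom a' b' c' = {(a', b, 1 - c), (a', b + \<beta>, 1 - c)}"
    using co \<open>b \<noteq> f\<close> \<open>c' = 1 - c\<close> by (auto simp: ydom_def \<beta>_def)
  moreover have "zdom e f = {(a' + \<alpha>, b + \<beta>, c), (a' + \<alpha>, b + \<beta>, 1 - c)}"
    using c by (auto simp: zdom_def \<alpha>_def \<beta>_def)
  ultimately have S1: "S = trit_tiling a' b c \<alpha> \<beta>"
    unfolding S_eq trit_tiling_def by simp
  have "S' = other_tiling a' b c \<alpha> \<beta>"
    using trit_tiling_unique[OF \<alpha> z] S' unfolding S1 Union_trit_tiling by blast
  moreover have "B = {a', a' + \<alpha>} \<times> {b, b + \<beta>} \<times> {c, 1 - c}"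
  proof -
    have "{l, l + 1} = {a', a' + \<alpha>}" "{m, m + 1} = {b, b + \<beta>}" "{n, n + 1} = {c, 1 - c}"
      using co c n \<open>b \<noteq> f\<close> \<open>a' \<noteq> e\<close> by (auto simp: \<alpha>_def \<beta>_def)
    then show ?thesis unfolding B by simp
  qed
  then have "B - \<Union>S = {(a' + \<alpha>, b, 1 - c), (a', b + \<beta>, c)}"
    unfolding S1 Union_trit_tiling trit_cells_def using \<alpha> c by (elim insertE emptyE disjE) auto
  ultimately show ?thesis
    using S1 \<alpha> z by blast
qed

text \<open>Evaluates the determinant at the new jewel over \<open>(x, y)\<close>. The path through
  it from \<open>h\<close> to \<open>h'\<close> makes one unit step along each axis, and exchanging
  \<open>h\<close> and \<open>h'\<close> leaves the value unchanged.\<close>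

lemma chi_other_tiling:
  assumes \<alpha>: "\<alpha> \<in> {1, -1}" "\<beta> \<in> {1, -1}" and z: "z \<in> {0, 1}"
    and h: "{h, h'} = {(x + \<alpha>, y, 1 - z), (x, y + \<beta>, z)}"
    and chi: "\<And>a b. {a, b} \<in> other_tiling x y z \<alpha> \<beta> \<Longrightarrow> share_face a h \<Longrightarrow> share_face b h' \<Longrightarrow> chi h a b h' = 1"
  shows "\<alpha> * \<beta> * (2 * z - 1) = 1"
proof -
  consider "h = (x + \<alpha>, y, 1 - z)" "h' = (x, y + \<beta>, z)" | "h' = (x + \<alpha>, y, 1 - z)" "h = (x, y + \<beta>, z)"
    using h by (auto simp: doubleton_eq_iff)
  then have "of_int (\<alpha> * \<beta> * (2 * z - 1)) = (1 :: real)"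
  proof cases
    case 1
    have "chi h (x, y, 1 - z) (x, y, z) h' = 1"
      using \<alpha> by (intro chi) (auto simp: 1 other_tiling_eq share_face_def)
    then show ?thesis
      by (simp add: chi_def 1 det_3 cube_center_def algebra_simps)
  next
    case 2
    have "chi h (x, y, z) (x, y, 1 - z) h' = 1"
      using \<alpha> by (intro chi) (auto simp: 2 other_tiling_eq share_face_def)
    then show ?thesis
      by (simp add: chi_def 2 det_3 cube_center_def algebra_simps)
  qed
  then show ?thesis using of_int_eq_1_iff by blast
qed

section \<open>The effect of a trit on the winding numbers\<close>

text \<open>Splits the drawing domino by domino, so that the dominoes common to two tilings cancel;
  a vertical one has no segment and contributes zero.\<close>

definition domino_winding :: "cell set \<Rightarrow> complex \<Rightarrow> complex" where
  "domino_winding d p = (\<Sum>g\<in>segments {d}. winding_number g p)"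

lemma total_winding_segments:
  assumes R: "two_layer R" and t: "tiling R t"
  shows "total_winding (segments t) p = (\<Sum>d\<in>t. domino_winding d p)"
proof -
  have "t \<subseteq> Pow R" using tiling_subset[OF t] by blast
  then have fin: "finite t"
    by (rule finite_subset) (use R in \<open>simp add: two_layer_def\<close>)
  have U: "segments t = (\<Union>d\<in>t. segments {d})"
    unfolding segments_def by blast
  have "segments {d} \<inter> segments {e} = {}" if de: "d \<in> t" "e \<in> t" "d \<noteq> e" for d e
  proof (rule ccontr)
    assume "segments {d} \<inter> segments {e} \<noteq> {}"
    then obtain g where "g \<in> segments {d}" "g \<in> segments {e}" by blast
    then obtain v b v' b' where g: "g = linepath (square_center (proj v)) (square_center (proj b))"
        "g = linepath (square_center (proj v')) (square_center (proj b'))"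
        "d = {v, b}" "e = {v', b'}" "white v" "white v'"
      unfolding segments_def by blast
    have "pathstart g = square_center (proj v)" "pathstart g = square_center (proj v')"
      by (subst g(1), simp) (subst g(2), simp)
    then have "proj v = proj v'"
      using square_center_eq_iff by metis
    moreover have "v \<in> R" "v' \<in> R"
      using tiling_subset[OF t de(1)] tiling_subset[OF t de(2)] g(3,4) by auto
    ultimately have "v = v'"
      using same_colour_eq[OF R] g(5,6) by blast
    then show False
      using tiling_unique[OF t de(1,2), of v] g(3,4) de(3) by auto
  qed
  moreover have "finite (segments {d})" if "d \<in> t" for d
    using finite_segments[OF R t] U that by (metis UN_upper finite_subset)
  ultimately show ?thesis
    unfolding total_winding_def U domino_winding_def using fin by (intro sum.UNION_disjoint) auto
qed

section \<open>Winding numbers of the sides of a unit square\<close>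

definition edge_winding :: "square \<Rightarrow> square \<Rightarrow> complex \<Rightarrow> complex" where
  "edge_winding q q' p = winding_number (linepath (square_center q) (square_center q')) p"

definition on_edge :: "complex \<Rightarrow> square \<Rightarrow> square \<Rightarrow> bool" where
  "on_edge p q q' \<longleftrightarrow> p \<in> closed_segment (square_center q) (square_center q')"

lemma on_edge_commute: "on_edge p q q' \<longleftrightarrow> on_edge p q' q"
  by (simp add: on_edge_def closed_segment_commute)

lemma edge_winding_reverse: "\<not> on_edge p q q' \<Longrightarrow> edge_winding q' q p = - edge_winding q q' p"
  using winding_number_reversepath[of "linepath (square_center q) (square_center q')" p]
  by (simp add: edge_winding_def on_edge_def)

lemma domino_winding_vertical: "domino_winding {(x, y, z), (x, y, z')} p = 0"
proof -
  have "segments {{(x, y, z), (x, y, z')}} = {}"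
    by (auto simp: segments_def doubleton_eq_iff proj_def)
  then show ?thesis by (simp add: domino_winding_def)
qed

text \<open>Segments run from white to black, while the edge on the right starts at
  \<open>c\<close>; the weight corrects the direction if \<open>c\<close> is black.\<close>

lemma domino_winding_horizontal:
  assumes s: "share_face c b" and ne: "proj c \<noteq> proj b" and p: "\<not> on_edge p (proj c) (proj b)"
  shows "domino_winding {c, b} p = of_int (weight 1 c) * edge_winding (proj c) (proj b) p"
proof -
  have seg: "segments {{c, b}} = {linepath (square_center (proj c)) (square_center (proj b))}"
    if "share_face c b" "white c" "proj c \<noteq> proj b" for c b
  proof (intro equalityI subsetI)
    fix g assume "g \<in> segments {{c, b}}"
    then obtain v d where v: "g = linepath (square_center (proj v)) (square_center (proj d))" "{v, d} = {c, b}"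
        "white v"
      unfolding segments_def by blast
    have "v \<noteq> b" using share_face_white[OF that(1)] that(2) v(3) by blast
    then have "v = c" "d = b" using v(2) by (auto simp only: doubleton_eq_iff)
    then show "g \<in> {linepath (square_center (proj c)) (square_center (proj b))}" using v(1) by simp
  next
    fix g assume "g \<in> {linepath (square_center (proj c)) (square_center (proj b))}"
    then show "g \<in> segments {{c, b}}"
      unfolding segments_def using that share_face_white[OF that(1)] by blast
  qed
  show ?thesis
  proof (cases "white c")
    case True
    then show ?thesis
      using seg[OF s True ne] by (simp add: domino_winding_def weight_def edge_winding_def)
  next
    case False
    then have "white b" using share_face_white[OF s] by blast
    then have "domino_winding {c, b} p = edge_winding (proj b) (proj c) p"
      using seg[of b c] s ne share_face_sym[of b c]
      by (simp add: domino_winding_def edge_winding_def insert_commute)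
    then show ?thesis
      using False edge_winding_reverse[OF p] by (simp add: weight_def)
  qed
qed

lemma on_edge_horizontal: "on_edge p (x, y) (x + 1, y) \<longleftrightarrow>
    Im p = of_int y + 1/2 \<and> of_int x + 1/2 \<le> Re p \<and> Re p \<le> of_int x + 3/2"
  and on_edge_vertical: "on_edge p (x, y) (x, y + 1) \<longleftrightarrow>
    Re p = of_int x + 1/2 \<and> of_int y + 1/2 \<le> Im p \<and> Im p \<le> of_int y + 3/2"
  by (auto simp: on_edge_def square_center_def closed_segment_same_Im closed_segment_same_Re
      closed_segment_eq_real_ivl)

definition off_boundary :: "complex \<Rightarrow> int \<Rightarrow> int \<Rightarrow> int \<Rightarrow> int \<Rightarrow> bool" where
  "off_boundary p x y \<alpha> \<beta> \<longleftrightarrow> \<not> on_edge p (x, y) (x + \<alpha>, y) \<and> \<not> on_edge p (x + \<alpha>, y) (x + \<alpha>, y + \<beta>) \<and>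
     \<not> on_edge p (x + \<alpha>, y + \<beta>) (x, y + \<beta>) \<and> \<not> on_edge p (x, y + \<beta>) (x, y)"

text \<open>The boundary of the unit square spanned by four neighbouring centres, run through
  counterclockwise exactly when \<alpha> and \<beta> have equal signs.\<close>

definition loop_winding :: "complex \<Rightarrow> int \<Rightarrow> int \<Rightarrow> int \<Rightarrow> int \<Rightarrow> complex" where
  "loop_winding p x y \<alpha> \<beta> = edge_winding (x, y) (x + \<alpha>, y) p + edge_winding (x + \<alpha>, y) (x + \<alpha>, y + \<beta>) p +
     edge_winding (x + \<alpha>, y + \<beta>) (x, y + \<beta>) p + edge_winding (x, y + \<beta>) (x, y) p"

lemma loop_winding_rectpath:
  assumes "off_boundary p x y 1 1"
  shows "loop_winding p x y 1 1 = winding_number (rectpath (square_center (x, y)) (square_center (x + 1, y + 1))) p"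
proof -
  have c: "Complex (Re (square_center (x + 1, y + 1))) (Im (square_center (x, y))) = square_center (x + 1, y)"
    "Complex (Re (square_center (x, y))) (Im (square_center (x + 1, y + 1))) = square_center (x, y + 1)"
    by (simp_all add: square_center_def)
  show ?thesis
    using assms unfolding rectpath_def Let_def c
    by (simp add: winding_number_join path_image_join off_boundary_def on_edge_def loop_winding_def
        edge_winding_def)
qed

lemma loop_winding_orientation:
  assumes \<alpha>: "\<alpha> \<in> {1, -1}" "\<beta> \<in> {1, -1}" and p: "off_boundary p x y \<alpha> \<beta>"
  shows "off_boundary p (min x (x + \<alpha>)) (min y (y + \<beta>)) 1 1"
    "loop_winding p x y \<alpha> \<beta> = of_int (\<alpha> * \<beta>) * loop_winding p (min x (x + \<alpha>)) (min y (y + \<beta>)) 1 1"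
proof -
  show "off_boundary p (min x (x + \<alpha>)) (min y (y + \<beta>)) 1 1"
    using \<alpha> p by (elim insertE emptyE) (simp_all add: off_boundary_def on_edge_commute)
  have r: "edge_winding q' q p = - edge_winding q q' p" if "\<not> on_edge p q q' \<or> \<not> on_edge p q' q" for q q'
    using edge_winding_reverse that on_edge_commute by blast
  have e: "edge_winding (x + \<alpha>, y) (x, y) p = - edge_winding (x, y) (x + \<alpha>, y) p"
    "edge_winding (x + \<alpha>, y + \<beta>) (x + \<alpha>, y) p = - edge_winding (x + \<alpha>, y) (x + \<alpha>, y + \<beta>) p"
    "edge_winding (x, y + \<beta>) (x + \<alpha>, y + \<beta>) p = - edge_winding (x + \<alpha>, y + \<beta>) (x, y + \<beta>) p"
    "edge_winding (x, y) (x, y + \<beta>) p = - edge_winding (x, y + \<beta>) (x, y) p"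
    using p by (auto simp: off_boundary_def intro!: r)
  show "loop_winding p x y \<alpha> \<beta> = of_int (\<alpha> * \<beta>) * loop_winding p (min x (x + \<alpha>)) (min y (y + \<beta>)) 1 1"
    using \<alpha> e by (elim insertE emptyE) (simp_all add: loop_winding_def)
qed

lemma loop_winding_inside:
  assumes \<alpha>: "\<alpha> \<in> {1, -1}" "\<beta> \<in> {1, -1}"
    and p: "p = square_center (x, y) + Complex (of_int \<alpha> / 2) (of_int \<beta> / 2)"
  shows "off_boundary p x y \<alpha> \<beta>" "loop_winding p x y \<alpha> \<beta> = of_int (\<alpha> * \<beta>)"
proof -
  let ?x = "min x (x + \<alpha>)" and ?y = "min y (y + \<beta>)"
  have Re: "Re p = of_int ?x + 1" and Im: "Im p = of_int ?y + 1"
    using \<alpha> by (auto simp: p square_center_def min_def field_simps)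
  \<comment> \<open>The centre of the block has integer coordinates, while the sides of the loop lie
    on half-integer lines.\<close>
  have n: "of_int a + 1 \<noteq> of_int b + (1/2 :: real)" for a b :: int
  proof
    assume "of_int a + 1 = of_int b + (1/2 :: real)"
    then have "of_int (2 * a + 1) = (of_int (2 * b) :: real)" by simp
    then have "2 * a + 1 = 2 * b" by (simp only: of_int_eq_iff)
    then show False by presburger
  qed
  have 1: "off_boundary p ?x ?y 1 1"
    unfolding off_boundary_def on_edge_commute[of p "(?x + 1, ?y + 1)"] on_edge_commute[of p "(?x, ?y + 1)"]
      on_edge_horizontal on_edge_vertical Re Im by (simp add: n)
  show 2: "off_boundary p x y \<alpha> \<beta>"
    using \<alpha> 1 by (elim insertE emptyE) (simp_all add: off_boundary_def on_edge_commute)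
  have "winding_number (rectpath (square_center (?x, ?y)) (square_center (?x + 1, ?y + 1))) p = 1"
    by (rule winding_number_rectpath) (simp add: in_box_complex_iff Re Im square_center_def)
  then show "loop_winding p x y \<alpha> \<beta> = of_int (\<alpha> * \<beta>)"
    using loop_winding_orientation(2)[OF \<alpha> 2] loop_winding_rectpath[OF 1] by simp
qed

lemma loop_winding_outside:
  assumes \<alpha>: "\<alpha> \<in> {1, -1}" "\<beta> \<in> {1, -1}"
    and j: "j \<notin> {(x, y), (x + \<alpha>, y), (x, y + \<beta>), (x + \<alpha>, y + \<beta>)}"
  shows "off_boundary (square_center j) x y \<alpha> \<beta>" "loop_winding (square_center j) x y \<alpha> \<beta> = 0"
proof -
  let ?x = "min x (x + \<alpha>)" and ?y = "min y (y + \<beta>)" and ?p = "square_center j"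
  obtain a b where ab: "j = (a, b)" by (cases j)
  have Re: "Re ?p = of_int a + 1/2" and Im: "Im ?p = of_int b + 1/2"
    by (simp_all add: ab square_center_def)
  have out: "\<not> ((a = ?x \<or> a = ?x + 1) \<and> (b = ?y \<or> b = ?y + 1))"
    using \<alpha> j by (auto simp: ab min_def)
  have between: "of_int m + 1/2 \<le> of_int k + (1/2 :: real) \<and> of_int k + (1/2 :: real) \<le> of_int m + 3/2 \<longleftrightarrow>
      k = m \<or> k = m + 1" for k m :: int
    by linarith
  have eq: "of_int k + (1/2 :: real) = of_int m + 1/2 \<longleftrightarrow> k = m" for k m :: int
    by simp
  have 1: "off_boundary ?p ?x ?y 1 1"
    unfolding off_boundary_def on_edge_commute[of ?p "(?x + 1, ?y + 1)"] on_edge_commute[of ?p "(?x, ?y + 1)"]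
      on_edge_horizontal on_edge_vertical Re Im between eq using out by blast
  show 2: "off_boundary ?p x y \<alpha> \<beta>"
    using \<alpha> 1 by (elim insertE emptyE) (simp_all add: off_boundary_def on_edge_commute)
  have "?p \<notin> cbox (square_center (?x, ?y)) (square_center (?x + 1, ?y + 1))"
    using out between[of ?x a] between[of ?y b] Re Im by (auto simp: in_cbox_complex_iff square_center_def)
  then have "winding_number (rectpath (square_center (?x, ?y)) (square_center (?x + 1, ?y + 1))) ?p = 0"
    by (intro winding_number_rectpath_outside) (auto simp: square_center_def)
  then show "loop_winding ?p x y \<alpha> \<beta> = 0"
    using loop_winding_orientation(2)[OF \<alpha> 2] loop_winding_rectpath[OF 1] by simp
qed

lemma sum_trit_tiling:
  assumes \<alpha>: "\<alpha> \<in> {1, -1}" "\<beta> \<in> {1, -1}" and z: "z \<in> {0, 1}"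
    and p: "\<not> on_edge p (x, y) (x + \<alpha>, y)" "\<not> on_edge p (x, y) (x, y + \<beta>)"
  shows "(\<Sum>d\<in>trit_tiling x y z \<alpha> \<beta>. domino_winding d p) = of_int (weight 1 (x, y, z)) *
    (edge_winding (x, y) (x + \<alpha>, y) p - edge_winding (x, y) (x, y + \<beta>) p)"
proof -
  have ne: "\<alpha> \<noteq> 0" "\<beta> \<noteq> 0" "z \<noteq> 1 - z" using \<alpha> z by auto
  have w: "weight 1 (x, y, 1 - z) = - weight 1 (x, y, z)"
    using z by (auto simp: weight_def white_def)
  have "share_face (x, y, z) (x + \<alpha>, y, z)" "share_face (x, y, 1 - z) (x, y + \<beta>, 1 - z)"
    using \<alpha> by (auto simp: share_face_def)
  from domino_winding_horizontal[OF this(1)] domino_winding_horizontal[OF this(2)]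
  have "domino_winding {(x, y, z), (x + \<alpha>, y, z)} p = of_int (weight 1 (x, y, z)) * edge_winding (x, y) (x + \<alpha>, y) p"
    "domino_winding {(x, y, 1 - z), (x, y + \<beta>, 1 - z)} p = - of_int (weight 1 (x, y, z)) * edge_winding (x, y) (x, y + \<beta>) p"
    using p ne by (simp_all add: proj_def w)
  moreover have "{(x, y, z), (x + \<alpha>, y, z)} \<noteq> {(x, y, 1 - z), (x, y + \<beta>, 1 - z)}"
    "{(x, y, z), (x + \<alpha>, y, z)} \<noteq> {(x + \<alpha>, y + \<beta>, z), (x + \<alpha>, y + \<beta>, 1 - z)}"
    "{(x, y, 1 - z), (x, y + \<beta>, 1 - z)} \<noteq> {(x + \<alpha>, y + \<beta>, z), (x + \<alpha>, y + \<beta>, 1 - z)}"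
    using ne by (simp_all add: doubleton_eq_iff)
  ultimately show ?thesis
    unfolding trit_tiling_def by (simp add: domino_winding_vertical algebra_simps)
qed

text \<open>Old and new segments form two paths with the same ends, around either side of the unit
  square, directed alike. Their difference closes up to its boundary.\<close>

lemma sum_trit_difference:
  assumes \<alpha>: "\<alpha> \<in> {1, -1}" "\<beta> \<in> {1, -1}" and z: "z \<in> {0, 1}" and p: "off_boundary p x y \<alpha> \<beta>"
  shows "(\<Sum>d\<in>other_tiling x y z \<alpha> \<beta>. domino_winding d p) - (\<Sum>d\<in>trit_tiling x y z \<alpha> \<beta>. domino_winding d p) =
    - of_int (weight 1 (x, y, z)) * loop_winding p x y \<alpha> \<beta>"
proof -
  have \<alpha>': "- \<alpha> \<in> {1, -1}" "- \<beta> \<in> {1, -1}" and z': "1 - z \<in> {0, 1}"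
    using \<alpha> z by auto
  have w: "weight 1 (x + \<alpha>, y + \<beta>, 1 - z) = - weight 1 (x, y, z)"
    using \<alpha> z by (auto simp: weight_def white_def)
  note off = p[unfolded off_boundary_def]
  have e: "edge_winding (x + \<alpha>, y + \<beta>) (x + \<alpha>, y) p = - edge_winding (x + \<alpha>, y) (x + \<alpha>, y + \<beta>) p"
    "edge_winding (x, y) (x, y + \<beta>) p = - edge_winding (x, y + \<beta>) (x, y) p"
    using off by (simp_all add: edge_winding_reverse)
  have 1: "(\<Sum>d\<in>other_tiling x y z \<alpha> \<beta>. domino_winding d p) = of_int (weight 1 (x + \<alpha>, y + \<beta>, 1 - z)) *
    (edge_winding (x + \<alpha>, y + \<beta>) (x, y + \<beta>) p - edge_winding (x + \<alpha>, y + \<beta>) (x + \<alpha>, y) p)"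
    unfolding other_tiling_def using off on_edge_commute[of p "(x + \<alpha>, y)" "(x + \<alpha>, y + \<beta>)"]
    by (subst sum_trit_tiling[OF \<alpha>' z']) simp_all
  have 2: "(\<Sum>d\<in>trit_tiling x y z \<alpha> \<beta>. domino_winding d p) = of_int (weight 1 (x, y, z)) *
    (edge_winding (x, y) (x + \<alpha>, y) p - edge_winding (x, y) (x, y + \<beta>) p)"
    using off on_edge_commute[of p "(x, y)" "(x, y + \<beta>)"] by (subst sum_trit_tiling[OF \<alpha> z]) simp_all
  show ?thesis
    unfolding 1 2 loop_winding_def w e by (simp add: algebra_simps)
qed

section \<open>Winding numbers at the jewels\<close>

text \<open>Segments lie on axis-parallel lines through centres. A half diagonal of the jewel's
  square meets such lines only at its own centre, where no segment can end. Ghost curves avoid the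
  whole closed square, since a jewel lies over a full square.\<close>

lemma jewel_avoids_drawing:
  assumes R: "two_layer R" and t: "tiling R t" and G: "ghost_curves R G" and j: "j \<in> jewels t"
    and s: "\<sigma> \<in> {1, -1}" "\<tau> \<in> {1, -1}"
    and p: "p \<in> closed_segment (square_center j) (square_center j + Complex (of_int \<sigma> / 2) (of_int \<tau> / 2))"
  shows "p \<notin> \<Union>(path_image ` (segments t \<union> G))"
proof -
  obtain a b where ab: "j = (a, b)" by (cases j)
  obtain u where u: "0 \<le> u" "u \<le> 1"
    and "p = (1 - u) *\<^sub>R square_center j + u *\<^sub>R (square_center j + Complex (of_int \<sigma> / 2) (of_int \<tau> / 2))"
    using p by (auto simp: in_segment)
  then have Re: "Re p = of_int a + 1/2 + u * of_int \<sigma> / 2" and Im: "Im p = of_int b + 1/2 + u * of_int \<tau> / 2"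
    by (simp_all add: ab square_center_def algebra_simps)
  have su: "\<bar>u * of_int \<sigma>\<bar> \<le> 1" "\<bar>u * of_int \<tau>\<bar> \<le> 1" "u * of_int \<sigma> = 0 \<longleftrightarrow> u = 0" "u * of_int \<tau> = 0 \<longleftrightarrow> u = 0"
    using s u by auto
  have half: "m = k \<and> v = 0" if "of_int m + 1/2 + v / 2 = of_int k + (1/2 :: real)" "\<bar>v\<bar> \<le> 1" for m k :: int and v
  proof -
    have "\<bar>of_int (k - m) :: real\<bar> < 1" using that by (simp add: abs_le_iff)
    then have "k = m" by linarith
    then show ?thesis using that by simp
  qed
  have edge: "j = (k, l) \<or> j = (k + 1, l)" if "on_edge p (k, l) (k + 1, l)" for k l
  proof -
    have "b = l \<and> u * of_int \<tau> = 0"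
      using that su(2) unfolding on_edge_horizontal Im by (intro half) auto
    then show ?thesis
      using that su(4) unfolding on_edge_horizontal Re ab by simp linarith
  qed
  have edge': "j = (k, l) \<or> j = (k, l + 1)" if "on_edge p (k, l) (k, l + 1)" for k l
  proof -
    have "a = k \<and> u * of_int \<sigma> = 0"
      using that su(1) unfolding on_edge_vertical Re by (intro half) auto
    then show ?thesis
      using that su(3) unfolding on_edge_vertical Im ab by simp linarith
  qed
  have "p \<notin> path_image g" if gt: "g \<in> segments t" for g
  proof
    assume p: "p \<in> path_image g"
    obtain v w where g: "g = linepath (square_center (proj v)) (square_center (proj w))" and vw: "{v, w} \<in> t"
      and ne: "proj v \<noteq> proj w"
      using gt unfolding segments_def by blast
    have on: "on_edge p (proj v) (proj w)"
      using p by (simp add: g on_edge_def)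
    obtain x y z x' y' z' where c: "v = (x, y, z)" "w = (x', y', z')" by (metis prod_cases3)
    have "\<bar>x - x'\<bar> + \<bar>y - y'\<bar> + \<bar>z - z'\<bar> = 1"
      using domino_share_face[OF tiling_domino[OF t vw]] by (simp add: c share_face_def)
    then consider "x' = x + 1 \<and> y' = y" | "x = x' + 1 \<and> y' = y" | "x' = x \<and> y' = y + 1" | "x' = x \<and> y = y' + 1"
      using ne by (cases "x = x'"; cases "y = y'") (auto simp: c proj_def abs_if split: if_splits)
    then have "j = proj v \<or> j = proj w"
      using on edge[of x y] edge[of x' y] edge'[of x y] edge'[of x y'] on_edge_commute[of p "proj v"]
      by cases (auto simp: c proj_def)
    then have "proj v \<in> jewels t \<or> proj w \<in> jewels t" using j by blast
    then show False
      using jewel_domino[OF R t vw] jewel_domino[OF R t, of w v] vw ne by (metis insert_commute)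
  qed
  moreover have "p \<notin> path_image g" if "g \<in> G" for g
  proof -
    have "{(a, b, 0), (a, b, 1)} \<in> t" using j by (simp add: ab jewels_def)
    then have "j \<in> full_squares R"
      using tiling_subset[OF t] by (auto simp: ab full_squares_def)
    moreover have "p \<in> plane_square j"
      using su(1,2) unfolding ab mem_plane_square Re Im by (simp add: abs_le_iff)
    ultimately have "p \<in> plane_body (full_squares R)" by (auto simp: plane_body_def)
    then show ?thesis using G that unfolding ghost_curves_def by blast
  qed
  ultimately show ?thesis by blast
qed

lemma jewel_exponent_total:
  assumes R: "two_layer R" and t: "tiling R t" and G: "ghost_curves R G" and j: "j \<in> jewels t"
  shows "of_int (jewel_exponent G t j) = total_winding (segments t \<union> G) (square_center j)"
    "\<sigma> \<in> {1, -1} \<Longrightarrow> \<tau> \<in> {1, -1} \<Longrightarrow> of_int (jewel_exponent G t j) =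
      total_winding (segments t \<union> G) (square_center j + Complex (of_int \<sigma> / 2) (of_int \<tau> / 2))"
proof -
  note sys = closed_system_drawing[OF R t G] and av = jewel_avoids_drawing[OF R t G j]
  have "square_center j \<notin> \<Union>(path_image ` (segments t \<union> G))"
    by (rule av[of 1 1]) simp_all
  from sum_wind_closed_curves[OF sys this]
  show 1: "of_int (jewel_exponent G t j) = total_winding (segments t \<union> G) (square_center j)"
    by (simp add: jewel_exponent_def)
  assume s: "\<sigma> \<in> {1, -1}" "\<tau> \<in> {1, -1}"
  let ?c = "square_center j + Complex (of_int \<sigma> / 2) (of_int \<tau> / 2)"
  have "total_winding (segments t \<union> G) (square_center j) = total_winding (segments t \<union> G) ?c"
    using av[OF s]
    by (intro total_winding_constant[OF sys, of "closed_segment (square_center j) ?c"]) auto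
  then show "of_int (jewel_exponent G t j) = total_winding (segments t \<union> G) ?c"
    using 1 by simp
qed

lemma total_winding_trit:
  assumes R: "two_layer R" and t: "tiling R t" "tiling R t'" and G: "ghost_curves R G"
    and S: "S \<subseteq> t" "(t - S) \<inter> S' = {}" "t' = (t - S) \<union> S'"
  shows "total_winding (segments t' \<union> G) p - total_winding (segments t \<union> G) p =
    (\<Sum>d\<in>S'. domino_winding d p) - (\<Sum>d\<in>S. domino_winding d p)"
proof -
  have split: "total_winding (segments u \<union> G) p = (\<Sum>d\<in>u. domino_winding d p) + total_winding G p"
    if "tiling R u" for u
    using finite_segments[OF R that] ghost_curves_ends(5)[OF R G] ghost_segments_disjoint[OF R that G]
      total_winding_segments[OF R that]
    by (simp add: total_winding_def sum.union_disjoint)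
  have fin: "finite u" if "tiling R u" for u
  proof -
    have "u \<subseteq> Pow R" using tiling_subset[OF that] by blast
    then show ?thesis by (rule finite_subset) (use R in \<open>simp add: two_layer_def\<close>)
  qed
  have "(\<Sum>d\<in>t. domino_winding d p) = (\<Sum>d\<in>t - S. domino_winding d p) + (\<Sum>d\<in>S. domino_winding d p)"
    by (rule sum.subset_diff[OF S(1) fin[OF t(1)]])
  moreover have "(\<Sum>d\<in>t'. domino_winding d p) = (\<Sum>d\<in>t - S. domino_winding d p) + (\<Sum>d\<in>S'. domino_winding d p)"
    unfolding S(3) by (rule sum.union_disjoint) (use fin[OF t(1)] fin[OF t(2)] S in auto)
  ultimately show ?thesis
    using split[OF t(1)] split[OF t(2)] by simp
qed

section \<open>Laurent polynomials at 1\<close>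

text \<open>The freedom in \<open>K\<close> lets two polynomials be summed over a common index set,
  even when coefficients cancel in their sum.\<close>

lemma laurent_eval_one:
  assumes "finite K" "Poly_Mapping.keys p \<subseteq> K"
  shows "laurent_eval p 1 = (\<Sum>k\<in>K. of_int (Poly_Mapping.lookup p k))"
  unfolding laurent_eval_def using assms
  by (intro sum.mono_neutral_cong_left) (auto simp: in_keys_iff)

lemma laurent_eval_one_add: "laurent_eval (p + q) 1 = laurent_eval p 1 + laurent_eval q 1"
proof -
  let ?K = "Poly_Mapping.keys p \<union> Poly_Mapping.keys q"
  have "finite ?K" "Poly_Mapping.keys (p + q) \<subseteq> ?K"
    using keys_add[of p q] by auto
  then show ?thesis
    using laurent_eval_one[of ?K] by (simp add: lookup_add sum.distrib)
qed

lemma laurent_eval_one_single: "laurent_eval (Poly_Mapping.single k a) 1 = of_int a"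
  using laurent_eval_one[of "{k}" "Poly_Mapping.single k a"] by simp

lemma laurent_eval_deriv:
  assumes "finite K" "Poly_Mapping.keys p \<subseteq> K"
  shows "laurent_eval (laurent_deriv p) 1 = (\<Sum>k\<in>K. of_int (k * Poly_Mapping.lookup p k))"
proof -
  have "laurent_eval (\<Sum>k\<in>A. f k) 1 = (\<Sum>k\<in>A. laurent_eval (f k) 1)" if "finite A" for A :: "int set" and f
  proof -
    have "laurent_eval 0 1 = 0" by (simp add: laurent_eval_def)
    with that show ?thesis
      by (induction rule: finite_induct) (auto simp: laurent_eval_one_add)
  qed
  then have "laurent_eval (laurent_deriv p) 1 = (\<Sum>k\<in>Poly_Mapping.keys p. of_int (k * Poly_Mapping.lookup p k))"
    by (simp add: laurent_deriv_def laurent_eval_one_single)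
  also have "\<dots> = (\<Sum>k\<in>K. of_int (k * Poly_Mapping.lookup p k))"
    using assms by (intro sum.mono_neutral_left) (auto simp: in_keys_iff)
  finally show ?thesis .
qed

lemma laurent_eval_deriv_add:
  "laurent_eval (laurent_deriv (p + q)) 1 = laurent_eval (laurent_deriv p) 1 + laurent_eval (laurent_deriv q) 1"
proof -
  let ?K = "Poly_Mapping.keys p \<union> Poly_Mapping.keys q"
  have "finite ?K" "Poly_Mapping.keys (p + q) \<subseteq> ?K"
    using keys_add[of p q] by auto
  then show ?thesis
    using laurent_eval_deriv[of ?K] by (simp add: lookup_add sum.distrib algebra_simps)
qed

lemma laurent_eval_deriv_single: "laurent_eval (laurent_deriv (Poly_Mapping.single k a)) 1 = of_int (k * a)"
  using laurent_eval_deriv[of "{k}" "Poly_Mapping.single k a"] by simp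

lemma q_power_mult_diff: "q_power k * (q_power 1 - 1) = (q_power (k + 1) - q_power k :: laurent)"
  by (simp add: right_diff_distrib mult_single)

section \<open>Positive trits\<close>

lemma jewels_Un: "jewels (u \<union> v) = jewels u \<union> jewels v"
  by (auto simp: jewels_def)

lemma jewels_trit_tiling:
  assumes \<alpha>: "\<alpha> \<in> {1, -1}" "\<beta> \<in> {1, -1}" and z: "z \<in> {0, 1}"
  shows "jewels (trit_tiling x y z \<alpha> \<beta>) = {(x + \<alpha>, y + \<beta>)}"
proof -
  have ne: "\<alpha> \<noteq> 0" "\<beta> \<noteq> 0" using \<alpha> by auto
  have "{(x + \<alpha>, y + \<beta>, z), (x + \<alpha>, y + \<beta>, 1 - z)} = {(x + \<alpha>, y + \<beta>, 0), (x + \<alpha>, y + \<beta>, 1)}"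
    using z by auto
  then show ?thesis
    using ne by (auto simp: jewels_def trit_tiling_def doubleton_eq_iff)
qed

lemma tiling_poly_trit:
  assumes R: "two_layer R" and t: "tiling R t" "tiling R t'" and G: "ghost_curves R G"
    and pos: "positive_trit R t t'"
  shows "\<exists>k. tiling_poly G t' + q_power k = tiling_poly G t + q_power (k + 1)"
proof -
  obtain B S S' h h' where tr: "trit_in R B S S' t t'" and h: "B - \<Union>S = {h, h'}"
    and chi: "\<forall>a b. {a, b} \<in> S' \<and> share_face a h \<and> share_face b h' \<longrightarrow> chi h a b h' = 1"
    using pos unfolding positive_trit_def by blast
  obtain x y z \<alpha> \<beta> where \<alpha>: "\<alpha> \<in> {1, -1}" "\<beta> \<in> {1, -1}" and z: "z \<in> {0, 1}"
    and S_eq: "S = trit_tiling x y z \<alpha> \<beta>" and S'_eq: "S' = other_tiling x y z \<alpha> \<beta>"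
    and B: "B - \<Union>S = {(x + \<alpha>, y, 1 - z), (x, y + \<beta>, z)}"
    using trit_in_shape[OF R tr] by blast
  have "\<alpha> * \<beta> * (2 * z - 1) = 1"
    by (rule chi_other_tiling[OF \<alpha> z, of h h' x y]) (use h B chi in \<open>auto simp: S'_eq\<close>)
  \<comment> \<open>The weight of \<open>(x, y, z)\<close> is the sign of its square times
    \<open>1 - 2 * z\<close>. The second factor will turn out to be the change of the
    exponent.\<close>
  then have sign: "square_sign (x, y) * (- weight 1 (x, y, z) * (\<alpha> * \<beta>)) = 1"
    using \<alpha> z by (auto simp: square_sign_def weight_def white_def)
  have S: "S \<subseteq> t" and S': "tiling (\<Union>S) S'" and t'_eq: "t' = (t - S) \<union> S'"
    using tr unfolding trit_in_def by blast+
  have disj: "(t - S) \<inter> S' = {}"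
    using tiling_exchange(2)[OF t(1) S S'] by blast
  let ?j = "(x + \<alpha>, y + \<beta>)" and ?j' = "(x, y)"
  define J where "J = jewels (t - S)"
  have jS: "jewels S = {?j}"
    using jewels_trit_tiling[OF \<alpha> z] by (simp add: S_eq)
  have jS': "jewels S' = {?j'}"
    using jewels_trit_tiling[of "- \<alpha>" "- \<beta>" "1 - z" "x + \<alpha>" "y + \<beta>"] \<alpha> z by (auto simp: S'_eq other_tiling_def)
  have jt: "jewels t = insert ?j J"
    using jewels_Un[of "t - S" S] S by (simp add: jS J_def Un_absorb2)
  have jt': "jewels t' = insert ?j' J"
    using jewels_Un[of "t - S" S'] by (simp add: t'_eq jS' J_def)
  have "?j \<in> jewels S" "?j' \<in> jewels S'" by (simp_all add: jS jS')
  \<comment> \<open>The columns over these squares are dominoes of \<open>S\<close> and of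
    \<open>S'\<close>, and both sets are disjoint from \<open>t - S\<close>.\<close>
  then have notin: "?j \<notin> J" "?j' \<notin> J"
    using disj by (auto simp: J_def jewels_def)
  have "jewels t \<subseteq> proj ` R"
    using tiling_subset[OF t(1)] by (force simp: jewels_def proj_def)
  then have "finite (jewels t)"
    by (rule finite_subset) (use R in \<open>simp add: two_layer_def\<close>)
  then have fin: "finite J" by (simp add: jt)
  have diff: "total_winding (segments t' \<union> G) p - total_winding (segments t \<union> G) p =
      - of_int (weight 1 (x, y, z)) * loop_winding p x y \<alpha> \<beta>" if "off_boundary p x y \<alpha> \<beta>" for p
    using total_winding_trit[OF R t G S disj t'_eq] sum_trit_difference[OF \<alpha> z that] by (simp add: S_eq S'_eq)
  have same: "jewel_exponent G t' i = jewel_exponent G t i" if i: "i \<in> J" for i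
  proof -
    have it: "i \<in> jewels t" "i \<in> jewels t'" using i by (simp_all add: jt jt')
    \<comment> \<open>These horizontal dominoes exclude jewels over the other two squares of the
      block, so the remaining jewels are off the loop.\<close>
    have "{(x + \<alpha>, y, z), (x, y, z)} \<in> t" "{(x, y + \<beta>, 1 - z), (x, y, 1 - z)} \<in> t"
      using S by (auto simp: S_eq trit_tiling_def insert_commute)
    from jewel_domino[OF R t(1) this(1)] jewel_domino[OF R t(1) this(2)]
    have "i \<noteq> (x + \<alpha>, y)" "i \<noteq> (x, y + \<beta>)"
      using it(1) \<alpha> by (auto simp: proj_def)
    then have "i \<notin> {(x, y), (x + \<alpha>, y), (x, y + \<beta>), (x + \<alpha>, y + \<beta>)}"
      using i notin by auto
    note out = loop_winding_outside[OF \<alpha> this]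
    have "total_winding (segments t' \<union> G) (square_center i) = total_winding (segments t \<union> G) (square_center i)"
      using diff[OF out(1)] by (simp add: out(2))
    then have "of_int (jewel_exponent G t' i) = (of_int (jewel_exponent G t i) :: complex)"
      using jewel_exponent_total(1)[OF R t(1) G it(1)] jewel_exponent_total(1)[OF R t(2) G it(2)] by simp
    then show ?thesis by simp
  qed
  let ?E = "jewel_exponent G t ?j" and ?E' = "jewel_exponent G t' ?j'"
  let ?c = "square_center (x, y) + Complex (of_int \<alpha> / 2) (of_int \<beta> / 2)"
  \<comment> \<open>The centre of the block is a corner of both jewel squares, which lets the two
    exponents be compared at one point.\<close>
  have c: "?c = square_center ?j + Complex (of_int (- \<alpha>) / 2) (of_int (- \<beta>) / 2)"
    by (simp add: square_center_def complex_eq_iff)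
  note ins = loop_winding_inside[OF \<alpha> refl, of x y]
  have "of_int ?E' = total_winding (segments t' \<union> G) ?c"
    by (rule jewel_exponent_total(2)[OF R t(2) G _ \<alpha>]) (simp add: jt')
  moreover have "of_int ?E = total_winding (segments t \<union> G) ?c"
    unfolding c by (rule jewel_exponent_total(2)[OF R t(1) G]) (use \<alpha> in \<open>auto simp: jt\<close>)
  ultimately have "of_int ?E' - of_int ?E = (of_int (- weight 1 (x, y, z) * (\<alpha> * \<beta>)) :: complex)"
    using diff[OF ins(1)] ins(2) by simp
  then have E: "?E' - ?E = - weight 1 (x, y, z) * (\<alpha> * \<beta>)"
    by (metis of_int_diff of_int_eq_iff)
  have sgn: "square_sign ?j = square_sign ?j'"
    using \<alpha> by (auto simp: square_sign_def)
  define P where "P = (\<Sum>i\<in>J. Poly_Mapping.single (jewel_exponent G t i) (square_sign i))"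
  have P: "tiling_poly G t = Poly_Mapping.single ?E (square_sign (x, y)) + P"
    unfolding tiling_poly_def jt P_def sgn[symmetric] by (rule sum.insert[OF fin notin(1)])
  have PJ: "(\<Sum>i\<in>J. Poly_Mapping.single (jewel_exponent G t' i) (square_sign i)) = P"
    unfolding P_def using same by (intro sum.cong) auto
  have P': "tiling_poly G t' = Poly_Mapping.single ?E' (square_sign (x, y)) + P"
    unfolding tiling_poly_def jt' by (subst sum.insert[OF fin notin(2)]) (simp only: PJ)
  show ?thesis
  proof (cases "square_sign (x, y) = 1")
    case True
    then have "?E' = ?E + 1" using sign E by simp
    then show ?thesis
      unfolding P P' True by (intro exI[of _ ?E]) (simp add: ac_simps)
  next
    \<comment> \<open>With sign -1 the old jewel has the larger exponent. Since both monomials are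
      negative, replacing the old by the new one again adds
      \<open>q_power (k + 1) - q_power k\<close>.\<close>
    case False
    then have m: "square_sign (x, y) = - 1" by (auto simp: square_sign_def split: if_splits)
    then have "?E = ?E' + 1" using sign E by simp
    then show ?thesis
      unfolding P P' m by (intro exI[of _ ?E']) (simp add: single_uminus)
  qed
qed

lemma two_story_two_layer: "two_story R \<Longrightarrow> two_layer R"
  by (auto simp: two_story_def two_layer_def)

theorem positive_trit_tiling_poly:
  assumes "two_story R" "ghost_curves R G" "tiling R t" "tiling R t'" "positive_trit R t t'"
  shows "\<exists>k. tiling_poly G t' - tiling_poly G t = q_power k * (q_power 1 - 1)"
    "laurent_eval (laurent_deriv (tiling_poly G t')) 1 - laurent_eval (laurent_deriv (tiling_poly G t)) 1 = 1"
proof -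
  obtain k where k: "tiling_poly G t' + q_power k = tiling_poly G t + q_power (k + 1)"
    using tiling_poly_trit[OF two_story_two_layer] assms by blast
  then have "tiling_poly G t' - tiling_poly G t = q_power (k + 1) - q_power k"
    by (simp add: algebra_simps)
  then show "\<exists>k. tiling_poly G t' - tiling_poly G t = q_power k * (q_power 1 - 1)"
    unfolding q_power_mult_diff by blast
  \<comment> \<open>In this form without subtraction additivity of the derivative suffices; the
    monomials contribute \<open>k\<close> and \<open>k + 1\<close>.\<close>
  have "laurent_eval (laurent_deriv (tiling_poly G t' + q_power k)) 1 =
      laurent_eval (laurent_deriv (tiling_poly G t + q_power (k + 1))) 1"
    by (simp only: k)
  then show "laurent_eval (laurent_deriv (tiling_poly G t')) 1 - laurent_eval (laurent_deriv (tiling_poly G t)) 1 = 1"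
    by (simp add: laurent_eval_deriv_add laurent_eval_deriv_single)
qed

theorem theorem1p2:
  shows "(\<forall>R G t0 t1.
            two_story R \<and> ghost_curves R G \<and> tiling R t0 \<and> tiling R t1 \<and> positive_trit R t0 t1 \<longrightarrow>
              (\<exists>k. tiling_poly G t1 - tiling_poly G t0 = q_power k * (q_power 1 - 1)) \<and>
              laurent_eval (laurent_deriv (tiling_poly G t1)) 1
                - laurent_eval (laurent_deriv (tiling_poly G t0)) 1 = 1)
       \<and> (\<forall>R t0 t1.
            duplex R \<and> tiling R t0 \<and> tiling R t1 \<longrightarrow>
              (\<lambda>t t'. flip R t t' \<or> trit R t t')\<^sup>*\<^sup>* t0 t1)"
  using positive_trit_tiling_poly duplex_connected by blast

end
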